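(* Let $d$ be a positive integer, $t\in(0,\infty)$, and let $\mathcal{H}=\mathcal{H}_d^t$ be the Hilbert function space on the open unit ball $\mathbb{B}_d\subset\mathbb{C}^d$ with kernel $k(x,y)=\frac{1}{(1-\langle x,y\rangle_{\mathbb{C}^d})^t}$. If $t\in(0,2]$, then for any two subsets $A,B\subset\mathbb{B}_d$, $\mathcal{H}_A$ is isometric to $\mathcal{H}_B$ (as Hilbert function spaces) if and only if $A$ and $B$ are congruent. If $t>2$, there exist non-congruent subsets $A,B\subset\mathbb{B}_d$ such that $\mathcal{H}_A$ and $\mathcal{H}_B$ are isometric (as Hilbert function spaces).
   Context: A Hilbert function space on a set $X$ is a Hilbert space of complex functions on $X$ with bounded point evaluations; its kernel functions $k_y$ satisfy $\langle f,k_y\rangle=f(y)$, and $k(x,y)=k_y(x)=\langle k_y,k_x\rangle$. In the kernel of $\mathcal{H}_d^t$, the power $z\mapsto z^t$ is defined with the principal branch of the logarithm on $\{\operatorname{Re} z>0\}$. For $A\subset\mathbb{B}_d$, $\mathcal{H}_A=\overline{\operatorname{span}\{k_a:a\in A\}}$ with the inner product of $\mathcal{H}$, regarded as a Hilbert function space on $A$ with kernel functions $k_a$, $a\in A$. $\mathcal{H}_A$ and $\mathcal{H}_B$ are isometric (as Hilbert function spaces) if there exist a surjective linear isometry $T:\mathcal{H}_A\to\mathcal{H}_B$, a bijection $\phi:A\to B$ and a function $f:A\to\mathbb{C}$ such that $T(k_a)=f(a)k_{\phi(a)}$ for all $a\in A$. Two subsets of $\mathbb{B}_d$ are congruent if there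 is a bi-holomorphic automorphism of $\mathbb{B}_d$ taking one onto the other. *)

theory Defs
  imports "HOL-Analysis.Analysis" "HOL-Library.Function_Algebras"
begin

definition cscale :: "complex \<Rightarrow> ('x \<Rightarrow> complex) \<Rightarrow> ('x \<Rightarrow> complex)"
  where "cscale c f = (\<lambda>x. c * f x)"

interpretation cfun: vector_space "cscale :: complex \<Rightarrow> ('x \<Rightarrow> complex) \<Rightarrow> ('x \<Rightarrow> complex)"
  by unfold_locales (auto simp: cscale_def fun_eq_iff algebra_simps)

definition hnorm :: "(('x \<Rightarrow> complex) \<Rightarrow> ('x \<Rightarrow> complex) \<Rightarrow> complex) \<Rightarrow> ('x \<Rightarrow> complex) \<Rightarrow> real"
  where "hnorm ip f = sqrt (Re (ip f f))"

text \<open>\<open>Metric_space\<close> requires a nonnegative and symmetric distance also off the carrier, hence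
  the case distinction.\<close>

definition hdist ::
  "('x \<Rightarrow> complex) set \<Rightarrow> (('x \<Rightarrow> complex) \<Rightarrow> ('x \<Rightarrow> complex) \<Rightarrow> complex)
    \<Rightarrow> ('x \<Rightarrow> complex) \<Rightarrow> ('x \<Rightarrow> complex) \<Rightarrow> real"
  where "hdist H ip f g = (if f \<in> H \<and> g \<in> H then hnorm ip (f - g) else 0)"

text \<open>A complex function on \<open>X\<close> is represented by a total function that vanishes off \<open>X\<close>, so that
  equality and the pointwise operations on total functions are those of functions on \<open>X\<close>.
  The inner product \<open>ip\<close> matters only on \<open>H\<close>; it is linear in the first argument.\<close>

locale hilbert_function_space =
  fixes X :: "'x set"
    and H :: "('x \<Rightarrow> complex) set"
    and ip :: "('x \<Rightarrow> complex) \<Rightarrow> ('x \<Rightarrow> complex) \<Rightarrow> complex"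
  assumes functions_on: "\<And>f x. f \<in> H \<Longrightarrow> x \<notin> X \<Longrightarrow> f x = 0"
    and subspace: "cfun.subspace H"
    and ip_add_left: "\<And>f g h. f \<in> H \<Longrightarrow> g \<in> H \<Longrightarrow> h \<in> H \<Longrightarrow> ip (f + g) h = ip f h + ip g h"
    and ip_scale_left: "\<And>c f g. f \<in> H \<Longrightarrow> g \<in> H \<Longrightarrow> ip (cscale c f) g = c * ip f g"
    and ip_commute: "\<And>f g. f \<in> H \<Longrightarrow> g \<in> H \<Longrightarrow> ip g f = cnj (ip f g)"
    and ip_pos: "\<And>f. f \<in> H \<Longrightarrow> f \<noteq> 0 \<Longrightarrow> Re (ip f f) > 0"
    and complete: "Metric_space.mcomplete H (hdist H ip)"
    and bounded_eval: "\<And>x. x \<in> X \<Longrightarrow> \<exists>C. \<forall>f\<in>H. cmod (f x) \<le> C * hnorm ip f"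

context hilbert_function_space
begin

lemma ip_add_right:
  assumes "f \<in> H" "g \<in> H" "h \<in> H"
  shows "ip h (f + g) = ip h f + ip h g"
  using assms ip_commute[of "f + g" h] ip_commute[of f h] ip_commute[of g h]
    ip_add_left[of f g h] cfun.subspace_add[OF subspace] by simp

lemma ip_scale_right:
  assumes "f \<in> H" "g \<in> H"
  shows "ip f (cscale c g) = cnj c * ip f g"
  using assms ip_commute[of "cscale c g" f] ip_commute[of g f]
    ip_scale_left[of g f c] cfun.subspace_scale[OF subspace] by simp

lemma ip_zero: "ip 0 0 = 0"
  using ip_scale_left[of 0 0 0] cfun.subspace_0[OF subspace] by simp

lemma ip_self_ge_0: "f \<in> H \<Longrightarrow> Re (ip f f) \<ge> 0"
  using ip_pos[of f] ip_zero by (cases "f = 0") auto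

lemma ip_self_real:
  assumes "f \<in> H" shows "ip f f = of_real (Re (ip f f))"
  using ip_commute[OF assms assms] by (auto simp: complex_eq_iff)

lemma hnorm_eq_0_iff: "f \<in> H \<Longrightarrow> hnorm ip f = 0 \<longleftrightarrow> f = 0"
  using ip_pos[of f] ip_zero by (cases "f = 0") (auto simp: hnorm_def)

lemma hnorm_power2: "f \<in> H \<Longrightarrow> (hnorm ip f)\<^sup>2 = Re (ip f f)"
  using ip_self_ge_0 by (simp add: hnorm_def)

lemma hnorm_nonneg: "f \<in> H \<Longrightarrow> hnorm ip f \<ge> 0"
  using ip_self_ge_0 by (simp add: hnorm_def)

lemma Re_ip_le:
  assumes f: "f \<in> H" and g: "g \<in> H"
  shows "Re (ip f g) \<le> hnorm ip f * hnorm ip g"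
proof (cases "f = 0 \<or> g = 0")
  case True
  have z: "ip 0 h = 0" "ip h 0 = 0" if "h \<in> H" for h
  proof -
    show "ip 0 h = 0"
      using ip_scale_left[OF that that, of 0] by simp
    show "ip h 0 = 0"
      using ip_scale_right[OF that that, of 0] by simp
  qed
  show ?thesis using True z f g hnorm_nonneg by (auto simp: hnorm_def)
next
  case False
  define a where "a = hnorm ip f"
  define b where "b = hnorm ip g"
  have a: "a > 0" and b: "b > 0"
    using False f g hnorm_eq_0_iff hnorm_nonneg unfolding a_def b_def
    by (metis less_eq_real_def)+
  define u where "u = cscale (of_real b) f"
  define v where "v = cscale (- of_real a) g"
  have u: "u \<in> H" and v: "v \<in> H"
    unfolding u_def v_def by (rule cfun.subspace_scale[OF subspace], fact)+
  have uv: "u + v \<in> H" using cfun.subspace_add[OF subspace u v] .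
  have fa: "ip f f = of_real (a\<^sup>2)"
    using ip_self_real[OF f] hnorm_power2[OF f] by (simp add: a_def)
  have gb: "ip g g = of_real (b\<^sup>2)"
    using ip_self_real[OF g] hnorm_power2[OF g] by (simp add: b_def)
  have "ip (u + v) (u + v) = ip u u + ip u v + ip v u + ip v v"
    using u v uv by (simp add: ip_add_left ip_add_right)
  moreover have "ip u u = of_real (b * b * a\<^sup>2)"
    using f u by (simp add: u_def ip_scale_left ip_scale_right fa cfun.subspace_scale[OF subspace])
  moreover have "ip v v = of_real (a * a * b\<^sup>2)"
    using g v by (simp add: v_def ip_scale_left ip_scale_right gb cfun.subspace_scale[OF subspace]
        del: cfun.scale_minus_left)
  moreover have "ip u v = - of_real (a * b) * ip f g"
    using f g by (simp add: u_def v_def ip_scale_left ip_scale_right cfun.subspace_scale[OF subspace]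
        del: cfun.scale_minus_left)
  moreover have "ip v u = - of_real (a * b) * cnj (ip f g)"
    using ip_commute[OF u v] calculation(4) by simp
  ultimately have "ip (u + v) (u + v) = of_real (b * b * a\<^sup>2) - of_real (a * b) * ip f g
      - of_real (a * b) * cnj (ip f g) + of_real (a * a * b\<^sup>2)"
    by simp
  then have "Re (ip (u + v) (u + v)) = b * b * a\<^sup>2 - a * b * Re (ip f g)
      - a * b * Re (ip f g) + a * a * b\<^sup>2"
    by (simp only: minus_complex.simps plus_complex.simps Re_complex_of_real times_complex.simps
        Im_complex_of_real cnj.simps mult_zero_left diff_0_right)
  then have "Re (ip (u + v) (u + v)) = 2 * (a * b) * (a * b - Re (ip f g))"
    by (simp add: power2_eq_square algebra_simps)
  then have "0 \<le> 2 * (a * b) * (a * b - Re (ip f g))"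
    using ip_self_ge_0[OF uv] by simp
  moreover have "0 < 2 * (a * b)" using a b by simp
  ultimately have "0 \<le> a * b - Re (ip f g)" by (simp only: zero_le_mult_iff) linarith
  then show ?thesis by (simp add: a_def b_def)
qed

lemma hnorm_triangle:
  assumes f: "f \<in> H" and g: "g \<in> H"
  shows "hnorm ip (f + g) \<le> hnorm ip f + hnorm ip g"
proof (rule power2_le_imp_le)
  have fg: "f + g \<in> H" using cfun.subspace_add[OF subspace f g] .
  have "Re (ip (f + g) (f + g)) = Re (ip f f) + 2 * Re (ip f g) + Re (ip g g)"
    using f g fg ip_commute[OF f g] by (simp add: ip_add_left ip_add_right)
  then show "(hnorm ip (f + g))\<^sup>2 \<le> (hnorm ip f + hnorm ip g)\<^sup>2"
    using Re_ip_le[OF f g] f g fg by (simp add: hnorm_power2 power2_sum)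
  show "0 \<le> hnorm ip f + hnorm ip g" using hnorm_nonneg f g by simp
qed

lemma Metric_space_hdist: "Metric_space H (hdist H ip)"
proof
  note diff = cfun.subspace_diff[OF subspace]
  show "hdist H ip f g \<ge> 0" for f g
    using diff hnorm_nonneg by (simp add: hdist_def)
  show "hdist H ip f g = hdist H ip g f" for f g
  proof (cases "f \<in> H \<and> g \<in> H")
    case True
    have "g - f = cscale (- 1) (f - g)"
      by (simp add: cscale_def fun_eq_iff)
    then have "ip (g - f) (g - f) = ip (f - g) (f - g)"
      using True diff cfun.subspace_scale[OF subspace]
      by (simp only: ip_scale_left ip_scale_right) simp
    then show ?thesis by (simp add: hdist_def hnorm_def)
  qed (auto simp: hdist_def)
  show "hdist H ip f g = 0 \<longleftrightarrow> f = g" if "f \<in> H" "g \<in> H" for f g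
    using that diff by (simp add: hdist_def hnorm_eq_0_iff)
  show "hdist H ip f h \<le> hdist H ip f g + hdist H ip g h" if "f \<in> H" "g \<in> H" "h \<in> H" for f g h
    using that diff hnorm_triangle[of "f - g" "g - h"] by (simp add: hdist_def)
qed

end

definition kernel_fun :: "'x set \<Rightarrow> ('x \<Rightarrow> 'x \<Rightarrow> complex) \<Rightarrow> 'x \<Rightarrow> ('x \<Rightarrow> complex)"
  where "kernel_fun X k y = (\<lambda>x. if x \<in> X then k x y else 0)"

locale hilbert_function_space_with_kernel = hilbert_function_space X H ip
  for X :: "'x set" and H ip +
  fixes k :: "'x \<Rightarrow> 'x \<Rightarrow> complex"
  assumes kernel_fun_in: "\<And>y. y \<in> X \<Longrightarrow> kernel_fun X k y \<in> H"
    and reproducing: "\<And>f y. y \<in> X \<Longrightarrow> f \<in> H \<Longrightarrow> ip f (kernel_fun X k y) = f y"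

text \<open>The elements of \<open>kernel_subspace H ip K A\<close> stay functions on \<open>X\<close>, with the inner product of
  \<open>H\<close>. An element that vanishes on \<open>A\<close> is orthogonal to every \<open>K a\<close>, hence zero, so restriction to
  \<open>A\<close> identifies this space with a space of functions on \<open>A\<close>.\<close>

definition kernel_subspace ::
  "('x \<Rightarrow> complex) set \<Rightarrow> (('x \<Rightarrow> complex) \<Rightarrow> ('x \<Rightarrow> complex) \<Rightarrow> complex)
    \<Rightarrow> ('x \<Rightarrow> ('x \<Rightarrow> complex)) \<Rightarrow> 'x set \<Rightarrow> ('x \<Rightarrow> complex) set"
  where "kernel_subspace H ip K A = Metric_space.mtopology H (hdist H ip) closure_of cfun.span (K ` A)"

text \<open>\<open>T\<close> is a total function, but all requirements concern only its restriction to the subspace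
  of \<open>A\<close>.\<close>

definition isometric_kernel_subspaces ::
  "('x \<Rightarrow> complex) set \<Rightarrow> (('x \<Rightarrow> complex) \<Rightarrow> ('x \<Rightarrow> complex) \<Rightarrow> complex)
    \<Rightarrow> ('x \<Rightarrow> ('x \<Rightarrow> complex)) \<Rightarrow> 'x set \<Rightarrow> 'x set \<Rightarrow> bool"
  where "isometric_kernel_subspaces H ip K A B \<longleftrightarrow>
    (\<exists>T \<phi> f.
      T ` kernel_subspace H ip K A = kernel_subspace H ip K B \<and>
      (\<forall>g\<in>kernel_subspace H ip K A. \<forall>h\<in>kernel_subspace H ip K A. T (g + h) = T g + T h) \<and>
      (\<forall>c. \<forall>g\<in>kernel_subspace H ip K A. T (cscale c g) = cscale c (T g)) \<and>
      (\<forall>g\<in>kernel_subspace H ip K A. hnorm ip (T g) = hnorm ip g) \<and>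
      bij_betw \<phi> A B \<and>
      (\<forall>a\<in>A. T (K a) = cscale (f a) (K (\<phi> a))))"

definition cinner_vec :: "complex ^ 'd \<Rightarrow> complex ^ 'd \<Rightarrow> complex"
  where "cinner_vec x y = (\<Sum>i\<in>UNIV. x $ i * cnj (y $ i))"

text \<open>On the unit ball the base of the power has positive real part, and the complex \<open>powr\<close> is
  defined through the principal logarithm.\<close>

definition ball_kernel :: "real \<Rightarrow> complex ^ 'd \<Rightarrow> complex ^ 'd \<Rightarrow> complex"
  where "ball_kernel t x y = 1 / (1 - cinner_vec x y) powr (of_real t)"

text \<open>Holomorphy in several variables: the real Frechet derivative exists and is complex linear.\<close>

definition holomorphic_map_on ::
  "(complex ^ 'd \<Rightarrow> complex ^ 'e) \<Rightarrow> (complex ^ 'd) set \<Rightarrow> bool"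
  where "holomorphic_map_on F S \<longleftrightarrow>
    (\<forall>x\<in>S. \<exists>D. (F has_derivative D) (at x) \<and> Vector_Spaces.linear (*s) (*s) D)"

definition biholomorphic_automorphism ::
  "(complex ^ 'd) set \<Rightarrow> (complex ^ 'd \<Rightarrow> complex ^ 'd) \<Rightarrow> bool"
  where "biholomorphic_automorphism S F \<longleftrightarrow>
    bij_betw F S S \<and> holomorphic_map_on F S \<and> holomorphic_map_on (inv_into S F) S"

definition congruent_in_ball :: "(complex ^ 'd) set \<Rightarrow> (complex ^ 'd) set \<Rightarrow> bool"
  where "congruent_in_ball A B \<longleftrightarrow> (\<exists>F. biholomorphic_automorphism (ball 0 1) F \<and> F ` A = B)"

end

theory Submission
  imports Defs "HOL-Complex_Analysis.Conformal_Mappings"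
begin

text \<open>An isometry of kernel subspaces is the same as a bijection \<open>\<phi>\<close> under which the Gram matrix of
  the kernel functions changes only by a rescaling \<open>f a * cnj (f b)\<close>. Automorphisms of the ball rescale
  the kernel in this way, since by the Schwarz lemma they are Moebius maps followed by unitaries.
  Conversely, moving a point of \<open>A\<close> and its image to the origin makes the rescaling trivial; as
  \<open>Re (1 - \<langle>x, y\<rangle>) > 0\<close>, the power \<open>z \<mapsto> z\<^sup>t\<close> is injective where needed for \<open>t \<le> 2\<close>, so the ordinary
  Gram matrices agree and \<open>\<phi>\<close> extends to a unitary. For \<open>t > 2\<close> it is not: a scalene triangle
  \<open>{0, x, y}\<close> on a complex line with \<open>arg (1 - \<langle>x, y\<rangle>) = \<pi>/t\<close> has the same kernel Gram matrix as its mirror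
  image, which no holomorphic automorphism reaches.\<close>

section \<open>The complex inner product\<close>

text \<open>The threshold 2 is a matter of arguments: those of
  \<open>1 - \<langle>x, y\<rangle>\<close> lie in (-pi/2, pi/2), so two of them, multiplied by
  \<open>t\<close>, can differ by a nonzero multiple of 2 pi only if \<open>t > 2\<close>; pi/t and
  -pi/t then do. The rescaling becomes trivial at the origin because the kernel is 1 as soon as one
  argument is 0, which forces the weights to be one unimodular constant. The delicate point about
  isometries is to build a map on a closed span from Gram data alone. It is described by values,
  \<open>h (\<phi> x) = f x * g x\<close>: completeness supplies such an \<open>h\<close>, and an
  element of a closed span is determined by its values on the base set. This weight on values and
  the multiplier on kernel functions are conjugate inverses of each other. To construct a
  congruence, Moebius maps and unitaries suffice; to derive an isometry from a congruence, or to
  refute a congruence, arbitrary automorphisms have to be controlled.\<close>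

lemma cinner_vec_add_left: "cinner_vec (x + y) z = cinner_vec x z + cinner_vec y z"
  by (simp add: cinner_vec_def distrib_right sum.distrib)

lemma cinner_vec_diff_left: "cinner_vec (x - y) z = cinner_vec x z - cinner_vec y z"
  by (simp add: cinner_vec_def left_diff_distrib sum_subtractf)

lemma cinner_vec_scale_left: "cinner_vec (c *s x) y = c * cinner_vec x y"
  by (simp add: cinner_vec_def sum_distrib_left mult.assoc)

lemma cnj_cinner_vec: "cnj (cinner_vec x y) = cinner_vec y x"
  by (simp add: cinner_vec_def mult.commute)

lemma cinner_vec_add_right: "cinner_vec z (x + y) = cinner_vec z x + cinner_vec z y"
  by (simp add: cinner_vec_def distrib_left sum.distrib)

lemma cinner_vec_diff_right: "cinner_vec z (x - y) = cinner_vec z x - cinner_vec z y"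
  by (simp add: cinner_vec_def right_diff_distrib sum_subtractf)

lemma cinner_vec_scale_right: "cinner_vec y (c *s x) = cnj c * cinner_vec y x"
  by (simp add: cinner_vec_def sum_distrib_left mult_ac)

lemma cinner_vec_zero [simp]: "cinner_vec 0 x = 0" "cinner_vec x 0 = 0"
  by (simp_all add: cinner_vec_def)

lemmas cinner_vec_simps = cinner_vec_add_left cinner_vec_diff_left cinner_vec_scale_left
  cinner_vec_add_right cinner_vec_diff_right cinner_vec_scale_right

lemma Re_cinner_vec: "Re (cinner_vec x y) = inner x y"
  by (simp add: cinner_vec_def inner_vec_def inner_complex_def)

lemma cinner_vec_self: "cinner_vec x x = of_real ((norm x)\<^sup>2)"
proof (rule complex_eqI)
  show "Re (cinner_vec x x) = Re (of_real ((norm x)\<^sup>2))"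
    by (simp add: Re_cinner_vec power2_norm_eq_inner)
  show "Im (cinner_vec x x) = Im (of_real ((norm x)\<^sup>2))"
    by (simp add: cinner_vec_def mult.commute)
qed

lemma norm_vector_smult: "norm (c *s x) = cmod c * norm (x :: complex ^ 'd)"
proof -
  have "of_real ((norm (c *s x))\<^sup>2) = c * cnj c * cinner_vec x x"
    unfolding cinner_vec_self[symmetric] by (simp add: cinner_vec_simps)
  also have "\<dots> = of_real ((cmod c * norm x)\<^sup>2)"
    by (simp add: cinner_vec_self power_mult_distrib flip: complex_norm_square)
  finally have "complex_of_real ((norm (c *s x))\<^sup>2) = of_real ((cmod c * norm x)\<^sup>2)" .
  then have "(norm (c *s x))\<^sup>2 = (cmod c * norm x)\<^sup>2"
    using of_real_eq_iff by blast
  then show ?thesis by simp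
qed

lemma scaleR_eq_vector_smult: "r *\<^sub>R x = of_real r *s (x :: complex ^ 'd)"
  by (simp add: vec_eq_iff scaleR_conv_of_real[where 'a = complex])

lemma cnj_sgn_mult: "cnj (sgn z) * z = of_real (cmod z)"
proof (cases "z = 0")
  case False
  have "cnj (sgn z) * z = (z * cnj z) / of_real (cmod z)"
    by (simp add: sgn_eq)
  also have "\<dots> = of_real (cmod z)"
    using False by (simp add: power2_eq_square flip: complex_norm_square)
  finally show ?thesis .
qed simp

text \<open>A unimodular factor on \<open>x\<close> makes the inner product real and nonnegative,
  and then the real Cauchy-Schwarz inequality applies.\<close>

lemma cmod_cinner_vec_le: "cmod (cinner_vec x y) \<le> norm x * norm y"
proof (cases "cinner_vec x y = 0")
  case False
  define c where "c = cnj (sgn (cinner_vec x y))"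
  have c: "cmod c = 1" using False by (simp add: c_def norm_sgn)
  have "cinner_vec (c *s x) y = of_real (cmod (cinner_vec x y))"
    by (simp add: cinner_vec_simps c_def cnj_sgn_mult)
  then have "cmod (cinner_vec x y) = inner (c *s x) y"
    by (simp flip: Re_cinner_vec)
  also have "\<dots> \<le> norm x * norm y"
    using norm_cauchy_schwarz[of "c *s x" y] by (simp add: norm_vector_smult c)
  finally show ?thesis .
qed simp

lemma cmod_cinner_vec_less_1:
  assumes "x \<in> ball 0 1" "y \<in> ball 0 1"
  shows "cmod (cinner_vec x y) < 1"
proof -
  have "norm x * norm y < 1 * 1"
    using assms by (intro mult_strict_mono') auto
  then show ?thesis using cmod_cinner_vec_le[of x y] by simp
qed

lemma Re_one_minus_cinner_vec_pos:
  assumes "x \<in> ball 0 1" "y \<in> ball 0 1"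
  shows "Re (1 - cinner_vec x y) > 0"
  using cmod_cinner_vec_less_1[OF assms] complex_Re_le_cmod[of "cinner_vec x y"] by simp

lemma one_minus_cinner_vec_nonzero:
  assumes "x \<in> ball 0 1" "y \<in> ball 0 1"
  shows "1 - cinner_vec x y \<noteq> 0"
  using Re_one_minus_cinner_vec_pos[OF assms] by (metis less_irrefl zero_complex.sel(1))

section \<open>Differentiability and linear isometries\<close>

lemma bounded_bilinear_vector_smult:
  "bounded_bilinear (\<lambda>c x. c *s (x :: complex ^ 'd))"
proof
  show "\<exists>K. \<forall>a (b :: complex ^ 'd). norm (a *s b) \<le> norm a * norm b * K"
    by (rule exI[of _ 1]) (simp add: norm_vector_smult)
qed (simp_all add: vec_eq_iff algebra_simps)

lemma bounded_linear_cinner_vec_left: "bounded_linear (\<lambda>x. cinner_vec x a)"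
proof
  show "\<exists>K. \<forall>x. norm (cinner_vec x a) \<le> norm x * K"
    using cmod_cinner_vec_le by blast
qed (simp_all add: cinner_vec_simps scaleR_eq_vector_smult scaleR_conv_of_real)

text \<open>Polarization recovers the real parts; the real part at \<open>\<i> *s x\<close> is, up
  to sign, the imaginary part at \<open>x\<close>.\<close>

lemma norm_preserving_imp_cinner_vec:
  assumes lin: "Vector_Spaces.linear (*s) (*s) (U :: complex ^ 'd \<Rightarrow> complex ^ 'e)"
    and nrm: "\<And>x. norm (U x) = norm x"
  shows "cinner_vec (U x) (U y) = cinner_vec x y"
proof -
  interpret U: Vector_Spaces.linear "(*s)" "(*s)" U by (rule lin)
  have re: "inner (U x) (U y) = inner x y" for x y
    using nrm[of "x + y"] by (simp add: dot_norm U.add nrm)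
  have "inner (U (\<i> *s x)) (U y) = inner (\<i> *s x) y" by (rule re)
  then have "Im (cinner_vec (U x) (U y)) = Im (cinner_vec x y)"
    by (simp add: U.scale cinner_vec_simps flip: Re_cinner_vec)
  moreover have "Re (cinner_vec (U x) (U y)) = Re (cinner_vec x y)"
    by (simp add: Re_cinner_vec re)
  ultimately show ?thesis by (simp add: complex_eq_iff)
qed

text \<open>\<open>inv_into S F\<close> is known only through its values on \<open>S\<close>;
  openness lets derivatives be read off from these.\<close>

lemma holomorphic_map_on_cong:
  assumes "open S" and F: "holomorphic_map_on F S" and eq: "\<And>x. x \<in> S \<Longrightarrow> F x = G x"
  shows "holomorphic_map_on G S"
  unfolding holomorphic_map_on_def
proof
  fix x assume x: "x \<in> S"
  with F obtain D where "(F has_derivative D) (at x)" and D: "Vector_Spaces.linear (*s) (*s) D"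
    unfolding holomorphic_map_on_def by blast
  from this(1) have "(G has_derivative D) (at x)"
    by (rule has_derivative_transform_within_open[OF _ \<open>open S\<close> x]) (rule eq)
  with D show "\<exists>D. (G has_derivative D) (at x) \<and> Vector_Spaces.linear (*s) (*s) D" by blast
qed

text \<open>Finite dimension turns injectivity into bijectivity, the inverse is again a linear
  isometry, and a bounded linear map is its own derivative.\<close>

lemma linear_isometry_biholomorphic:
  assumes lin: "Vector_Spaces.linear (*s) (*s) (U :: complex ^ 'd \<Rightarrow> complex ^ 'd)"
    and nrm: "\<And>x. norm (U x) = norm x"
  shows "biholomorphic_automorphism (ball 0 1) U"
proof -
  interpret U: Vector_Spaces.linear "(*s)" "(*s)" U by (rule lin)
  have inj: "inj U"
    by (rule injI) (metis U.diff nrm norm_eq_zero right_minus_eq)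
  have "surj U"
    by (rule vec.linear_inj_imp_surj[OF lin inj])
  with inj have bij: "bij U" by (simp add: bij_def)
  define V where "V = inv U"
  have UV: "U (V x) = x" and VU: "V (U x) = x" for x
    using bij by (simp_all add: V_def bij_def surj_f_inv_f)
  have linV: "Vector_Spaces.linear (*s) (*s) V"
    by unfold_locales (metis U.add UV VU, metis U.scale UV VU)
  have nrmV: "norm (V x) = norm x" for x by (metis UV nrm)
  have bl: "bounded_linear W" if "Vector_Spaces.linear (*s) (*s) W" "\<And>x. norm (W x) = norm x"
    for W :: "complex ^ 'd \<Rightarrow> complex ^ 'd"
  proof -
    interpret W: Vector_Spaces.linear "(*s)" "(*s)" W by (rule that)
    show ?thesis
      by (rule bounded_linear_intro[of _ 1])
         (simp_all add: W.add W.scale scaleR_eq_vector_smult that)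
  qed
  have hol: "holomorphic_map_on W S" if "Vector_Spaces.linear (*s) (*s) W" "\<And>x. norm (W x) = norm x"
    for W :: "complex ^ 'd \<Rightarrow> complex ^ 'd" and S
    unfolding holomorphic_map_on_def
    using bounded_linear_imp_has_derivative[OF bl[OF that]] that(1) by blast
  have bb: "bij_betw U (ball 0 1) (ball 0 1)"
    by (rule bij_betwI[where g = V]) (auto simp: UV VU nrm nrmV)
  have "V x = inv_into (ball 0 1) U x" if "x \<in> ball 0 1" for x
    by (rule sym, rule inv_into_f_eq) (use inj UV that nrmV in \<open>auto simp: inj_on_def\<close>)
  moreover have "holomorphic_map_on V (ball 0 1)" by (rule hol[OF linV nrmV])
  ultimately have "holomorphic_map_on (inv_into (ball 0 1) U) (ball 0 1)"
    using holomorphic_map_on_cong[OF open_ball] by blast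
  with bb hol[OF lin nrm] show ?thesis
    by (simp add: biholomorphic_automorphism_def)
qed

section \<open>Automorphisms of the ball\<close>

lemma holomorphic_map_on_compose:
  assumes F: "holomorphic_map_on F S" and G: "holomorphic_map_on G T" and ST: "F ` S \<subseteq> T"
  shows "holomorphic_map_on (G \<circ> F) S"
  unfolding holomorphic_map_on_def
proof
  fix x assume x: "x \<in> S"
  obtain D where D: "(F has_derivative D) (at x)" "Vector_Spaces.linear (*s) (*s) D"
    using F x unfolding holomorphic_map_on_def by blast
  obtain E where E: "(G has_derivative E) (at (F x))" "Vector_Spaces.linear (*s) (*s) E"
    using G x ST unfolding holomorphic_map_on_def by blast
  have "(G \<circ> F has_derivative E \<circ> D) (at x)"
    by (rule diff_chain_at[OF D(1) E(1)])
  moreover have "Vector_Spaces.linear (*s) (*s) (E \<circ> D)"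
    by (rule Vector_Spaces.linear_compose[OF D(2) E(2)])
  ultimately show "\<exists>D. (G \<circ> F has_derivative D) (at x) \<and> Vector_Spaces.linear (*s) (*s) D"
    by blast
qed

lemma biholomorphic_automorphism_compose:
  assumes F: "biholomorphic_automorphism S F" and G: "biholomorphic_automorphism S G"
    and "open S"
  shows "biholomorphic_automorphism S (G \<circ> F)"
proof -
  have bF: "bij_betw F S S" and bG: "bij_betw G S S"
    using F G by (auto simp: biholomorphic_automorphism_def)
  have bGF: "bij_betw (G \<circ> F) S S" by (rule bij_betw_trans[OF bF bG])
  have hF: "holomorphic_map_on F S" "holomorphic_map_on (inv_into S F) S"
    and hG: "holomorphic_map_on G S" "holomorphic_map_on (inv_into S G) S"
    using F G unfolding biholomorphic_automorphism_def by blast+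
  have im: "F ` S \<subseteq> S" "inv_into S G ` S \<subseteq> S"
    using bF bij_betw_inv_into[OF bG] by (simp_all add: bij_betw_def)
  have "holomorphic_map_on (inv_into S F \<circ> inv_into S G) S"
    by (rule holomorphic_map_on_compose[OF hG(2) hF(2) im(2)])
  moreover have "(inv_into S F \<circ> inv_into S G) x = inv_into S (G \<circ> F) x" if x: "x \<in> S" for x
  proof -
    have "inv_into S G x \<in> S" using x bG by (metis bij_betw_def inv_into_into)
    moreover have "inv_into S F (inv_into S G x) \<in> S"
      using calculation bF by (metis bij_betw_def inv_into_into)
    moreover have "(G \<circ> F) (inv_into S F (inv_into S G x)) = x"
      using calculation x bF bG by (simp add: bij_betw_inv_into_right)
    ultimately show ?thesis using bGF by (simp add: bij_betw_def inv_into_f_eq)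
  qed
  ultimately have "holomorphic_map_on (inv_into S (G \<circ> F)) S"
    by (rule holomorphic_map_on_cong[OF \<open>open S\<close>])
  moreover have "holomorphic_map_on (G \<circ> F) S"
    by (rule holomorphic_map_on_compose[OF hF(1) hG(1) im(1)])
  ultimately show ?thesis using bGF unfolding biholomorphic_automorphism_def by blast
qed

section \<open>Moebius involutions\<close>

text \<open>Rudin's \<open>\<phi>\<^sub>a z = (a - P z - s Q z) / (1 - \<langle>z, a\<rangle>)\<close>, with \<open>s = sqrt (1 - |a|\<^sup>2)\<close> and \<open>P\<close>, \<open>Q\<close> the
  orthogonal projections onto the line of \<open>a\<close> and its complement; since \<open>(1 - s) / |a|\<^sup>2 = 1 / (1 + s)\<close>,
  the form below covers \<open>a = 0\<close> as well.\<close>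

definition ball_moebius :: "complex ^ 'd \<Rightarrow> complex ^ 'd \<Rightarrow> complex ^ 'd" where
  "ball_moebius a z = (let s = complex_of_real (sqrt (1 - (norm a)\<^sup>2)) in
     inverse (1 - cinner_vec z a) *s ((1 - cinner_vec z a / (1 + s)) *s a - s *s z))"

lemma ball_moebius_0: "ball_moebius a 0 = a"
  by (simp add: ball_moebius_def)

text \<open>The central identity: \<open>x = y\<close> shows that the ball is preserved,
  \<open>y = 0\<close> computes the denominator in the involution property, and its
  \<open>t\<close>-th power is the rescaling of the kernel.\<close>

lemma one_minus_cinner_ball_moebius:
  assumes a: "a \<in> ball 0 1" and x: "x \<in> ball 0 1" and y: "y \<in> ball 0 1"
  shows "1 - cinner_vec (ball_moebius a x) (ball_moebius a y) =
    of_real (1 - (norm a)\<^sup>2) * (1 - cinner_vec x y) / ((1 - cinner_vec x a) * (1 - cinner_vec a y))"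
proof -
  define r where "r = sqrt (1 - (norm a)\<^sup>2)"
  define s where "s = complex_of_real r"
  have na: "(norm a)\<^sup>2 < 1" using a by (simp add: power_less_one_iff)
  have r: "r > 0" "r\<^sup>2 = 1 - (norm a)\<^sup>2" using na by (auto simp: r_def)
  have s1: "1 + s \<noteq> 0"
    unfolding s_def using r by (metis add_pos_pos of_real_1 of_real_add of_real_eq_0_iff order_less_irrefl zero_less_one)
  \<comment> \<open>This factorization of \<open>|a|\<^sup>2\<close> cancels the denominators
    \<open>1 + s\<close>.\<close>
  have "complex_of_real ((norm a)\<^sup>2) = of_real ((1 - r) * (1 + r))"
    unfolding of_real_eq_iff using r(2) by (simp add: algebra_simps power2_eq_square)
  then have aa: "cinner_vec a a = (1 - s) * (1 + s)"
    by (simp add: cinner_vec_self s_def)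
  define p where "p = cinner_vec x a"
  define q where "q = cinner_vec a y"
  define w where "w = cinner_vec x y"
  have p: "1 - p \<noteq> 0" and q: "1 - q \<noteq> 0"
    using one_minus_cinner_vec_nonzero a x y by (auto simp: p_def q_def)
  have cq: "cnj (cinner_vec y a) = q" by (simp add: q_def cnj_cinner_vec)
  define \<alpha> where "\<alpha> = 1 - p / (1 + s)"
  define \<beta> where "\<beta> = 1 - q / (1 + s)"
  have cs: "cnj s = s" by (simp add: s_def)
  have "ball_moebius a x = inverse (1 - p) *s (\<alpha> *s a - s *s x)"
    by (simp add: ball_moebius_def Let_def r_def[symmetric] s_def[symmetric] p_def \<alpha>_def)
  \<comment> \<open>The factors at \<open>y\<close> are written as conjugates because the second
    slot of the inner product conjugates them back.\<close>
  moreover have "ball_moebius a y = cnj (inverse (1 - q)) *s (cnj \<beta> *s a - s *s y)"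
    by (simp add: ball_moebius_def Let_def r_def[symmetric] s_def[symmetric] cq[symmetric] \<beta>_def cs)
  ultimately have "cinner_vec (ball_moebius a x) (ball_moebius a y)
    = inverse (1 - p) * inverse (1 - q) *
      (\<alpha> * \<beta> * ((1 - s) * (1 + s)) - s * \<alpha> * q - s * \<beta> * p + s\<^sup>2 * w)"
    by (simp add: cinner_vec_simps aa p_def[symmetric] q_def[symmetric] w_def[symmetric] cs
        power2_eq_square) (simp add: algebra_simps)
  also have "\<alpha> * \<beta> * ((1 - s) * (1 + s)) - s * \<alpha> * q - s * \<beta> * p + s\<^sup>2 * w
      = (1 - p) * (1 - q) - s\<^sup>2 * (1 - w)"
  proof -
    \<comment> \<open>With a name for the reciprocal, a polynomial identity modulo
      \<open>(1 + s) * u = 1\<close> remains.\<close>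
    define u where "u = inverse (1 + s)"
    have u: "(1 + s) * u = 1" using s1 by (simp add: u_def)
    have "(1 - p * u) * (1 - q * u) * ((1 - s) * (1 + s))
        - s * (1 - p * u) * q - s * (1 - q * u) * p + s\<^sup>2 * w
      = (1 - p) * (1 - q) - s\<^sup>2 * (1 - w)"
      using u by algebra
    then show ?thesis by (simp add: u_def \<alpha>_def \<beta>_def divide_inverse)
  qed
  also have "1 - inverse (1 - p) * inverse (1 - q) * ((1 - p) * (1 - q) - s\<^sup>2 * (1 - w))
    = s\<^sup>2 * (1 - w) / ((1 - p) * (1 - q))"
    using p q unfolding right_diff_distrib[of "inverse (1 - p) * inverse (1 - q)"]
    by (simp add: divide_inverse mult_ac)
  finally show ?thesis
    using r by (simp add: s_def p_def q_def w_def flip: of_real_power)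
qed

text \<open>On the diagonal the central identity writes
  \<open>1 - |ball_moebius a x|\<^sup>2\<close> as a quotient of positive reals.\<close>

lemma ball_moebius_in_ball:
  assumes a: "a \<in> ball 0 1" and x: "x \<in> ball 0 1"
  shows "ball_moebius a x \<in> ball 0 1"
proof -
  have pos: "0 < 1 - (norm a)\<^sup>2" "0 < 1 - (norm x)\<^sup>2"
    using a x by (simp_all add: power_less_one_iff)
  have "of_real (1 - (norm (ball_moebius a x))\<^sup>2)
      = of_real (1 - (norm a)\<^sup>2) * (1 - cinner_vec x x) / ((1 - cinner_vec x a) * cnj (1 - cinner_vec x a))"
    using one_minus_cinner_ball_moebius[OF a x x]
    by (simp add: cinner_vec_self cnj_cinner_vec)
  also have "\<dots> = of_real ((1 - (norm a)\<^sup>2) * (1 - (norm x)\<^sup>2) / (cmod (1 - cinner_vec x a))\<^sup>2)"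
    by (simp add: cinner_vec_self complex_norm_square[symmetric] del: complex_cnj_diff)
  finally have "1 - (norm (ball_moebius a x))\<^sup>2
      = (1 - (norm a)\<^sup>2) * (1 - (norm x)\<^sup>2) / (cmod (1 - cinner_vec x a))\<^sup>2"
    using of_real_eq_iff by blast
  also have "\<dots> > 0"
    using pos one_minus_cinner_vec_nonzero[OF x a] by simp
  finally show ?thesis by (simp add: power_less_one_iff abs_square_less_1)
qed

lemma ball_moebius_involution:
  assumes a: "a \<in> ball 0 1" and x: "x \<in> ball 0 1"
  shows "ball_moebius a (ball_moebius a x) = x"
proof -
  define r where "r = sqrt (1 - (norm a)\<^sup>2)"
  define s where "s = complex_of_real r"
  have na: "(norm a)\<^sup>2 < 1" using a by (simp add: power_less_one_iff)
  have r: "r > 0" "r\<^sup>2 = 1 - (norm a)\<^sup>2" using na by (auto simp: r_def)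
  have s1: "1 + s \<noteq> 0" and s0: "s \<noteq> 0"
    unfolding s_def using r
    by (metis add_pos_pos of_real_1 of_real_add of_real_eq_0_iff order_less_irrefl zero_less_one, simp)
  define p where "p = cinner_vec x a"
  have p: "1 - p \<noteq> 0"
    using one_minus_cinner_vec_nonzero a x by (auto simp: p_def)
  \<comment> \<open>The point \<open>a\<close> is the image of 0, so this is the central identity
    with second point 0.\<close>
  have "1 - cinner_vec (ball_moebius a x) a = s\<^sup>2 / (1 - p)"
    using one_minus_cinner_ball_moebius[OF a x, of 0] r a
    by (simp add: ball_moebius_0 p_def s_def flip: of_real_power)
  then have q: "cinner_vec (ball_moebius a x) a = 1 - s\<^sup>2 / (1 - p)"
    by (metis diff_diff_eq2 add_diff_cancel_left' diff_add_cancel)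
  have "ball_moebius a (ball_moebius a x) $ i = x $ i" for i
  proof -
    define u where "u = inverse (1 + s)"
    define v where "v = inverse (1 - p)"
    define z where "z = inverse s"
    have u: "(1 + s) * u = 1" and v: "(1 - p) * v = 1" and z: "s * z = 1"
      using s1 p s0 by (auto simp: u_def v_def z_def)
    have moebius: "ball_moebius a w $ i
        = inverse (1 - cinner_vec w a) * ((1 - cinner_vec w a * u) * a $ i - s * w $ i)" for w
      by (simp add: ball_moebius_def Let_def r_def[symmetric] s_def[symmetric] u_def divide_inverse
          right_diff_distrib left_diff_distrib mult.assoc)
    have "inverse (1 - cinner_vec (ball_moebius a x) a) = (1 - p) * z\<^sup>2"
      unfolding q by (simp add: z_def field_simps)
    then have "ball_moebius a (ball_moebius a x) $ i
        = (1 - p) * z\<^sup>2 * ((1 - (1 - s\<^sup>2 * v) * u) * a $ i - s * ball_moebius a x $ i)"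
      using moebius[of "ball_moebius a x"] by (simp add: q v_def divide_inverse)
    moreover have "ball_moebius a x $ i = v * ((1 - p * u) * a $ i - s * x $ i)"
      using moebius[of x] by (simp add: p_def v_def)
    ultimately show ?thesis using u v z by algebra
  qed
  then show ?thesis by (simp add: vec_eq_iff)
qed

lemma holomorphic_ball_moebius:
  assumes a: "a \<in> ball 0 1"
  shows "holomorphic_map_on (ball_moebius a) (ball 0 1)"
  unfolding holomorphic_map_on_def
proof
  fix x :: "complex ^ 'a" assume x: "x \<in> ball 0 1"
  define s where "s = complex_of_real (sqrt (1 - (norm a)\<^sup>2))"
  define g where "g = (\<lambda>z. inverse (1 - cinner_vec z a))"
  define n where "n = (\<lambda>z. (1 - cinner_vec z a / (1 + s)) *s a - s *s z)"
  define g' where "g' = (\<lambda>h. g x * cinner_vec h a * g x)"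
  define n' where "n' = (\<lambda>h. (- cinner_vec h a / (1 + s)) *s a - s *s h)"
  note [derivative_intros] = bounded_linear.has_derivative[OF bounded_linear_cinner_vec_left]
    bounded_linear.has_derivative[OF bounded_bilinear.bounded_linear_left[OF bounded_bilinear_vector_smult]]
    bounded_linear.has_derivative[OF bounded_bilinear.bounded_linear_right[OF bounded_bilinear_vector_smult]]
  have "(g has_derivative g') (at x)"
    unfolding g_def g'_def
    by (rule derivative_eq_intros refl one_minus_cinner_vec_nonzero x a)+ (simp add: fun_eq_iff)
  moreover have "(n has_derivative n') (at x)"
    unfolding n_def n'_def divide_inverse
    by (rule derivative_eq_intros refl)+ (simp add: fun_eq_iff)
  ultimately have "((\<lambda>z. g z *s n z) has_derivative (\<lambda>h. g x *s n' h + g' h *s n x)) (at x)"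
    by (rule bounded_bilinear.FDERIV[OF bounded_bilinear_vector_smult])
  moreover have "(\<lambda>z. g z *s n z) = ball_moebius a"
    by (simp add: ball_moebius_def fun_eq_iff g_def n_def Let_def s_def)
  moreover have "Vector_Spaces.linear (*s) (*s) (\<lambda>h. g x *s n' h + g' h *s n x)"
    by unfold_locales
      (simp_all add: vec_eq_iff n'_def g'_def cinner_vec_simps algebra_simps add_divide_distrib)
  ultimately show "\<exists>D. (ball_moebius a has_derivative D) (at x) \<and> Vector_Spaces.linear (*s) (*s) D"
    by auto
qed

lemma ball_moebius_automorphism:
  assumes a: "a \<in> ball 0 1"
  shows "biholomorphic_automorphism (ball 0 1) (ball_moebius a)"
proof -
  have bb: "bij_betw (ball_moebius a) (ball 0 1) (ball 0 1)"
    using a by (intro bij_betwI[where g = "ball_moebius a"])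
      (auto simp: ball_moebius_involution intro: ball_moebius_in_ball simp del: mem_ball mem_ball_0)
  have "ball_moebius a x = inv_into (ball 0 1) (ball_moebius a) x" if "x \<in> ball 0 1" for x
    using bb inv_into_f_eq[of "ball_moebius a" "ball 0 1" "ball_moebius a x" x] that a
    by (simp add: bij_betw_def ball_moebius_involution ball_moebius_in_ball del: mem_ball mem_ball_0)
  then have "holomorphic_map_on (inv_into (ball 0 1) (ball_moebius a)) (ball 0 1)"
    using holomorphic_map_on_cong[OF open_ball holomorphic_ball_moebius[OF a]] by blast
  then show ?thesis
    using bb holomorphic_ball_moebius[OF a] by (simp add: biholomorphic_automorphism_def)
qed

section \<open>Schwarz lemma and automorphisms\<close>

text \<open>Reduced to the Schwarz lemma on the disc through
  \<open>\<lambda> \<mapsto> \<langle>F (\<lambda> z / |z|), F z / |F z|\<rangle>\<close>.\<close>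

lemma schwarz_ball:
  fixes F :: "complex ^ 'd \<Rightarrow> complex ^ 'e"
  assumes hol: "holomorphic_map_on F (ball 0 1)" and F: "F ` ball 0 1 \<subseteq> ball 0 1" and F0: "F 0 = 0"
    and z: "z \<in> ball 0 1"
  shows schwarz_ball_le: "norm (F z) \<le> norm z"
    and schwarz_ball_eq:
      "\<lbrakk>\<And>w. w \<in> ball 0 1 \<Longrightarrow> norm (F w) = norm w; 0 \<le> r; r \<le> 1\<rbrakk> \<Longrightarrow> F (r *\<^sub>R z) = r *\<^sub>R F z"
proof -
  \<comment> \<open>As \<open>inverse 0 = 0\<close>, these vectors are 0 when \<open>z\<close> or
    \<open>F z\<close> is; hence the nonvanishing conditions on the facts below.\<close>
  define u where "u = of_real (inverse (norm z)) *s z"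
  define v where "v = of_real (inverse (norm (F z))) *s F z"
  define h where "h = (\<lambda>l. cinner_vec (F (l *s u)) v)"
  have zF: "z \<noteq> 0" if "F z \<noteq> 0" using that F0 by auto
  have uball: "l *s u \<in> ball 0 1" if "z \<noteq> 0" "cmod l < 1" for l
    using that by (simp add: u_def norm_vector_smult norm_mult norm_inverse mult.assoc)
  have v1: "norm v = 1" if "F z \<noteq> 0" using that by (simp add: v_def norm_vector_smult norm_inverse)
  have zu: "of_real (norm z) *s u = z" if "z \<noteq> 0"
    using that by (simp add: u_def vec_eq_iff flip: of_real_mult)
  have hz: "h (of_real (norm z)) = of_real (norm (F z))" if "F z \<noteq> 0"
    using that zF by (simp add: h_def zu v_def cinner_vec_simps cinner_vec_self power2_eq_square)
  have h0: "h 0 = 0" by (simp add: h_def F0)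
  have holh: "h holomorphic_on ball 0 1" if "z \<noteq> 0"
  proof (rule holomorphic_onI)
    fix l :: complex assume "l \<in> ball 0 1"
    then have "l *s u \<in> ball 0 1" using uball that by simp
    then obtain D where D: "(F has_derivative D) (at (l *s u))" and lin: "Vector_Spaces.linear (*s) (*s) D"
      using hol unfolding holomorphic_map_on_def by blast
    interpret D: Vector_Spaces.linear "(*s)" "(*s)" D by (rule lin)
    have "((\<lambda>l. l *s u) has_derivative (\<lambda>m. m *s u)) (at l)"
      by (intro bounded_linear_imp_has_derivative
          bounded_bilinear.bounded_linear_left[OF bounded_bilinear_vector_smult])
    from bounded_linear.has_derivative[OF bounded_linear_cinner_vec_left[of v] diff_chain_at[OF this D]]
    have "(h has_derivative (\<lambda>m. cinner_vec (D (m *s u)) v)) (at l)"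
      by (simp add: h_def o_def)
    \<comment> \<open>Complex linearity of \<open>D\<close> makes the real derivative a
      multiplication by a complex number, that is, a complex derivative.\<close>
    moreover have "(\<lambda>m. cinner_vec (D (m *s u)) v) = (*) (cinner_vec (D u) v)"
      by (simp add: D.scale cinner_vec_simps fun_eq_iff)
    ultimately have "(h has_field_derivative (cinner_vec (D u) v)) (at l)"
      by (simp add: has_field_derivative_def)
    then show "h field_differentiable at l within ball 0 1"
      using field_differentiable_at_within field_differentiable_def by blast
  qed
  have hle: "cmod (h l) \<le> norm (F (l *s u))" if "F z \<noteq> 0" for l
    using cmod_cinner_vec_le[of "F (l *s u)" v] v1[OF that] by (simp add: h_def)
  have h1: "cmod (h l) < 1" if "F z \<noteq> 0" "cmod l < 1" for l
    using hle[OF that(1), of l] F uball[OF zF[OF that(1)] that(2)]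
    by (smt (verit, best) image_subset_iff mem_ball_0)
  show le: "norm (F z) \<le> norm z"
  proof (cases "F z = 0")
    case False
    have "cmod (h (of_real (norm z))) \<le> cmod (of_real (norm z))"
      by (rule Schwarz_Lemma[OF holh h0 h1]) (use False zF z in auto)
    then show ?thesis using hz[OF False] by simp
  qed simp
  show "F (r *\<^sub>R z) = r *\<^sub>R F z"
    if nrm: "\<And>w. w \<in> ball 0 1 \<Longrightarrow> norm (F w) = norm w" and r: "0 \<le> r" "r \<le> 1"
  proof (cases "z = 0")
    case False
    then have Fz: "F z \<noteq> 0" using nrm[OF z] by auto
    \<comment> \<open>\<open>h\<close> attains equality in the Schwarz lemma at \<open>|z|\<close>,
      so it is a rotation; its positive value there makes the rotation trivial.\<close>
    have "\<exists>\<alpha>. (\<forall>l. norm l < 1 \<longrightarrow> h l = \<alpha> * l) \<and> norm \<alpha> = 1"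
    proof (rule Schwarz_Lemma(3)[OF holh h0 h1, of 0])
      show "(\<exists>l. cmod l < 1 \<and> l \<noteq> 0 \<and> cmod (h l) = cmod l) \<or> cmod (deriv h 0) = 1"
        using hz[OF Fz] nrm[OF z] z False by (intro disjI1 exI[of _ "of_real (norm z)"]) auto
    qed (use False Fz in auto)
    then obtain \<alpha> where \<alpha>: "\<And>l. cmod l < 1 \<Longrightarrow> h l = \<alpha> * l" by blast
    have "\<alpha> = 1" using \<alpha>[of "of_real (norm z)"] hz[OF Fz] nrm[OF z] z False by auto
    define l where "l = r * norm z"
    have l: "0 \<le> l" "l < 1" using r z mult_left_le_one_le[of "norm z" r]
      by (auto simp: l_def intro: le_less_trans)
    have hl: "cinner_vec (F (of_real l *s u)) v = of_real l"
      using \<alpha>[of "of_real l"] \<open>\<alpha> = 1\<close> l by (simp add: h_def)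
    have nl: "norm (F (of_real l *s u)) = l"
      using nrm[OF uball[OF False, of "of_real l"]] l False
      by (simp add: norm_vector_smult u_def norm_mult norm_inverse mult.assoc)
    \<comment> \<open>Equality case of Cauchy-Schwarz: a vector of norm \<open>l\<close> whose inner
      product with the unit vector \<open>v\<close> is \<open>l\<close> equals
      \<open>l *\<^sub>R v\<close>.\<close>
    have "(norm (F (of_real l *s u) - l *\<^sub>R v))\<^sup>2
        = (norm (F (of_real l *s u)))\<^sup>2 - 2 * l * inner (F (of_real l *s u)) v + l\<^sup>2 * (norm v)\<^sup>2"
      using dot_norm_neg[of "F (of_real l *s u)" "l *\<^sub>R v"] by (simp add: power_mult_distrib)
    also have "\<dots> = 0"
      using hl nl v1[OF Fz] by (simp add: power2_eq_square flip: Re_cinner_vec)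
    finally have "F (of_real l *s u) = l *\<^sub>R v" by simp
    moreover have "of_real l *s u = r *\<^sub>R z"
      using False by (simp add: l_def u_def vec_eq_iff scaleR_conv_of_real[where 'a = complex])
    moreover have "l *\<^sub>R v = r *\<^sub>R F z"
      using False nrm[OF z] by (simp add: l_def v_def vec_eq_iff scaleR_conv_of_real[where 'a = complex])
    ultimately show ?thesis by simp
  qed (simp add: F0)
qed

text \<open>The Schwarz lemma for \<open>F\<close> and for its inverse gives
  \<open>norm (F z) = norm z\<close>. The equality case makes \<open>F\<close> homogeneous along
  rays, so \<open>F\<close> agrees on the ball with its derivative at 0, a complex linear
  isometry.\<close>

lemma automorphism_fixing_0_cinner:
  fixes F :: "complex ^ 'd \<Rightarrow> complex ^ 'd"
  assumes F: "biholomorphic_automorphism (ball 0 1) F" and F0: "F 0 = 0"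
    and x: "x \<in> ball 0 1" and y: "y \<in> ball 0 1"
  shows "cinner_vec (F x) (F y) = cinner_vec x y"
proof -
  define G where "G = inv_into (ball 0 1) F"
  have bij: "bij_betw F (ball 0 1) (ball 0 1)" and hol: "holomorphic_map_on F (ball 0 1)"
    and holG: "holomorphic_map_on G (ball 0 1)"
    using F by (auto simp: biholomorphic_automorphism_def G_def)
  have GF: "G (F z) = z" if "z \<in> ball 0 1" for z
    using bij_betw_inv_into_left[OF bij that] by (simp add: G_def)
  have im: "F ` ball 0 1 \<subseteq> ball 0 1" "G ` ball 0 1 \<subseteq> ball 0 1"
    using bij bij_betw_inv_into[OF bij] by (auto simp: bij_betw_def G_def)
  have G0: "G 0 = 0" using GF[of 0] F0 by simp
  have nrm: "norm (F z) = norm z" if z: "z \<in> ball 0 1" for z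
  proof (rule antisym)
    show "norm (F z) \<le> norm z" by (rule schwarz_ball_le[OF hol im(1) F0 z])
    have "F z \<in> ball 0 1" using im z by blast
    from schwarz_ball_le[OF holG im(2) G0 this] show "norm z \<le> norm (F z)" using GF[OF z] by simp
  qed
  obtain D where D: "(F has_derivative D) (at 0)" and lin: "Vector_Spaces.linear (*s) (*s) D"
    using hol unfolding holomorphic_map_on_def by (metis centre_in_ball zero_less_one)
  interpret D: Vector_Spaces.linear "(*s)" "(*s)" D by (rule lin)
  have FD: "F z = D z" if z: "z \<in> ball 0 1" for z
  proof -
    \<comment> \<open>The derivative of \<open>F\<close> along the ray through \<open>z\<close> is
      computed twice, by the chain rule and by homogeneity. It is one-sided because homogeneity is
      known only for \<open>r\<close> in \<open>{0..1}\<close>.\<close>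
    have "((\<lambda>r::real. r *\<^sub>R z) has_derivative (\<lambda>r. r *\<^sub>R z)) (at 0)"
      by (rule derivative_eq_intros refl)+ simp
    then have "((\<lambda>r::real. F (r *\<^sub>R z)) has_derivative (\<lambda>r. D (r *\<^sub>R z))) (at 0)"
      using diff_chain_at[of "\<lambda>r::real. r *\<^sub>R z" _ 0 F D] D by (simp add: o_def)
    then have "((\<lambda>r::real. F (r *\<^sub>R z)) has_vector_derivative D z) (at 0)"
      by (simp add: has_vector_derivative_def scaleR_eq_vector_smult D.scale)
    then have 1: "((\<lambda>r::real. F (r *\<^sub>R z)) has_vector_derivative D z) (at 0 within {0..1})"
      by (rule has_vector_derivative_at_within)
    have "((\<lambda>r::real. r *\<^sub>R F z) has_vector_derivative F z) (at 0 within {0..1})"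
      by (rule derivative_eq_intros refl)+ simp
    then have 2: "((\<lambda>r::real. F (r *\<^sub>R z)) has_vector_derivative F z) (at 0 within {0..1})"
      by (rule has_vector_derivative_transform[rotated 2])
         (use schwarz_ball_eq[OF hol im(1) F0 z nrm] in auto)
    show ?thesis
      by (rule vector_derivative_unique_within[OF _ 2 1])
         (simp add: trivial_limit_within islimpt_Icc)
  qed
  have "norm (D z) = norm z" for z
  proof -
    \<comment> \<open>Scaling by \<open>c\<close> moves an arbitrary vector into the ball, where the
      norm is already known to be preserved.\<close>
    define c where "c = inverse (norm z + 1)"
    have c: "c > 0" by (simp add: c_def add_nonneg_pos)
    have "c *\<^sub>R z \<in> ball 0 1"
      using divide_less_eq_1_pos[of "1 + norm z" "norm z"] add_pos_nonneg[of 1 "norm z"]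
      by (simp add: c_def divide_inverse mult.commute add.commute)
    from nrm[OF this] FD[OF this] have "norm (c *\<^sub>R D z) = norm (c *\<^sub>R z)"
      by (simp add: scaleR_eq_vector_smult D.scale)
    then show ?thesis using c by simp
  qed
  from norm_preserving_imp_cinner_vec[OF lin this] show ?thesis
    by (simp add: FD x y del: mem_ball mem_ball_0)
qed

text \<open>With \<open>a\<close> the zero of \<open>F\<close>, the map
  \<open>F \<circ> ball_moebius a\<close> fixes 0 and so preserves inner products; as
  \<open>ball_moebius a\<close> is an involution, \<open>F\<close> inherits the Moebius
  identity.\<close>

lemma automorphism_cinner:
  fixes F :: "complex ^ 'd \<Rightarrow> complex ^ 'd"
  assumes F: "biholomorphic_automorphism (ball 0 1) F"
  obtains a where "a \<in> ball 0 1"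
    "\<And>x y. \<lbrakk>x \<in> ball 0 1; y \<in> ball 0 1\<rbrakk> \<Longrightarrow> 1 - cinner_vec (F x) (F y) =
       of_real (1 - (norm a)\<^sup>2) * (1 - cinner_vec x y) / ((1 - cinner_vec x a) * (1 - cinner_vec a y))"
proof -
  have "0 \<in> F ` ball 0 1" using F by (simp add: biholomorphic_automorphism_def bij_betw_def)
  then obtain a where a: "a \<in> ball 0 1" "F a = 0" by (metis imageE)
  define G where "G = F \<circ> ball_moebius a"
  have G: "biholomorphic_automorphism (ball 0 1) G"
    unfolding G_def by (intro biholomorphic_automorphism_compose ball_moebius_automorphism a F) simp
  have G0: "G 0 = 0" by (simp add: G_def ball_moebius_0 a)
  have FG: "F x = G (ball_moebius a x)" if "x \<in> ball 0 1" for x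
    using that a by (simp add: G_def ball_moebius_involution del: mem_ball mem_ball_0)
  show ?thesis
  proof (rule that[OF a(1)])
    fix x y :: "complex ^ 'd" assume xy: "x \<in> ball 0 1" "y \<in> ball 0 1"
    then show "1 - cinner_vec (F x) (F y) = of_real (1 - (norm a)\<^sup>2) * (1 - cinner_vec x y)
        / ((1 - cinner_vec x a) * (1 - cinner_vec a y))"
      using automorphism_fixing_0_cinner[OF G G0 ball_moebius_in_ball[OF a(1) xy(1)]
          ball_moebius_in_ball[OF a(1) xy(2)]] one_minus_cinner_ball_moebius[OF a(1) xy]
      by (simp add: FG)
  qed
qed

section \<open>Isometries of kernel subspaces\<close>

context hilbert_function_space
begin

lemmas H_add = cfun.subspace_add[OF subspace]
  and H_diff = cfun.subspace_diff[OF subspace]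
  and H_scale = cfun.subspace_scale[OF subspace]

lemma ip_diff_right: "\<lbrakk>f \<in> H; g \<in> H; h \<in> H\<rbrakk> \<Longrightarrow> ip h (f - g) = ip h f - ip h g"
  using ip_add_right[of "f - g" g h] H_diff by (simp add: algebra_simps)

lemma hnorm_scale:
  assumes f: "f \<in> H"
  shows "hnorm ip (cscale c f) = cmod c * hnorm ip f"
proof -
  have "ip (cscale c f) (cscale c f) = (c * cnj c) * ip f f"
    using f H_scale[OF f] by (simp add: ip_scale_left ip_scale_right)
  also have "\<dots> = of_real ((cmod c)\<^sup>2 * Re (ip f f))"
    by (subst ip_self_real[OF f]) (simp add: complex_norm_square del: of_real_power)
  finally have "Re (ip (cscale c f) (cscale c f)) = (cmod c)\<^sup>2 * Re (ip f f)"
    by (simp only: Re_complex_of_real)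
  then show ?thesis by (simp add: hnorm_def real_sqrt_mult)
qed

lemma hnorm_diff_commute: "\<lbrakk>f \<in> H; g \<in> H\<rbrakk> \<Longrightarrow> hnorm ip (f - g) = hnorm ip (g - f)"
  using Metric_space.commute[OF Metric_space_hdist, of f g] by (simp add: hdist_def)

text \<open>Bounded evaluation turns norm convergence into pointwise convergence, so that equations
  between values pass to limits.\<close>

lemma tendsto_eval:
  assumes u: "\<And>n. u n \<in> H" and g: "g \<in> H" and lim: "(\<lambda>n. hnorm ip (u n - g)) \<longlonglongrightarrow> 0"
    and x: "x \<in> X"
  shows "(\<lambda>n. u n x) \<longlonglongrightarrow> g x"
proof -
  obtain C where C: "\<And>f. f \<in> H \<Longrightarrow> cmod (f x) \<le> C * hnorm ip f"
    using bounded_eval[OF x] by blast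
  have "(\<lambda>n. (u n - g) x) \<longlonglongrightarrow> 0"
    by (rule Lim_null_comparison[where g = "\<lambda>n. C * hnorm ip (u n - g)"])
      (use C u g H_diff tendsto_mult_right_zero[OF lim] in \<open>auto simp del: minus_apply\<close>)
  then have "(\<lambda>n. u n x - g x) \<longlonglongrightarrow> 0"
    by simp
  then show ?thesis by (simp add: LIM_zero_iff)
qed

lemma tendsto_hnorm:
  assumes u: "\<And>n. u n \<in> H" and g: "g \<in> H" and lim: "(\<lambda>n. hnorm ip (u n - g)) \<longlonglongrightarrow> 0"
  shows "(\<lambda>n. hnorm ip (u n)) \<longlonglongrightarrow> hnorm ip g"
proof -
  have "\<bar>hnorm ip (u n) - hnorm ip g\<bar> \<le> hnorm ip (u n - g)" for n
    using hnorm_triangle[of "u n - g" g] hnorm_triangle[of "g - u n" "u n"] u[of n] g H_diff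
      hnorm_diff_commute[of "u n" g] by simp
  then have "(\<lambda>n. hnorm ip (u n) - hnorm ip g) \<longlonglongrightarrow> 0"
    by (intro Lim_null_comparison[OF _ lim]) simp
  then show ?thesis by (simp add: LIM_zero_iff)
qed

lemma Cauchy_imp_tendsto:
  assumes u: "\<And>n. u n \<in> H"
    and cauchy: "\<And>e. e > 0 \<Longrightarrow> \<exists>N. \<forall>m\<ge>N. \<forall>n\<ge>N. hnorm ip (u m - u n) < e"
  obtains g where "g \<in> H" "(\<lambda>n. hnorm ip (u n - g)) \<longlonglongrightarrow> 0"
proof -
  interpret M: Metric_space H "hdist H ip" by (rule Metric_space_hdist)
  have "M.MCauchy u"
    unfolding M.MCauchy_def using u cauchy by (auto simp: hdist_def)
  then obtain g where "limitin M.mtopology u g sequentially"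
    using complete unfolding M.mcomplete_def by blast
  then have g: "g \<in> H" and lim: "\<And>e. e > 0 \<Longrightarrow> \<forall>\<^sub>F n in sequentially. hdist H ip (u n) g < e"
    unfolding M.limitin_metric by (auto elim: eventually_mono)
  have "(\<lambda>n. hnorm ip (u n - g)) \<longlonglongrightarrow> 0"
    unfolding tendsto_iff
    using lim u g hnorm_nonneg H_diff by (simp add: hdist_def dist_real_def)
  with g show ?thesis by (rule that)
qed

text \<open>Isometries are defined through norms, Gram matrices through inner products;
  polarization, applied also to \<open>cscale \<i> g\<close>, bridges the two.\<close>

lemma ip_eq_if_hnorm_eq:
  assumes lin: "cfun.subspace V" "V \<subseteq> H" "\<And>g. g \<in> V \<Longrightarrow> T g \<in> H"
    and add: "\<And>g h. \<lbrakk>g \<in> V; h \<in> V\<rbrakk> \<Longrightarrow> T (g + h) = T g + T h"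
    and scale: "\<And>c g. g \<in> V \<Longrightarrow> T (cscale c g) = cscale c (T g)"
    and nrm: "\<And>g. g \<in> V \<Longrightarrow> hnorm ip (T g) = hnorm ip g"
    and g: "g \<in> V" and h: "h \<in> V"
  shows "ip (T g) (T h) = ip g h"
proof -
  have polar: "2 * Re (ip u v) = (hnorm ip (u + v))\<^sup>2 - (hnorm ip u)\<^sup>2 - (hnorm ip v)\<^sup>2"
    if "u \<in> H" "v \<in> H" for u v
    using that H_add ip_commute[of u v] by (simp add: hnorm_power2 ip_add_left ip_add_right)
  have re: "Re (ip (T g) (T h)) = Re (ip g h)" if "g \<in> V" "h \<in> V" for g h
    using that polar[of "T g" "T h"] polar[of g h] lin cfun.subspace_add[OF lin(1)]
    by (auto simp: add[symmetric] nrm subset_iff)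
  have "Re (ip (T (cscale \<i> g)) (T h)) = Re (ip (cscale \<i> g) h)"
    by (rule re[OF cfun.subspace_scale[OF lin(1) g] h])
  then have "Im (ip (T g) (T h)) = Im (ip g h)"
    using g h lin by (simp add: scale ip_scale_left subset_iff)
  with re[OF g h] show ?thesis by (simp add: complex_eq_iff)
qed

end

section \<open>Closed spans of kernel functions\<close>

context hilbert_function_space_with_kernel
begin

abbreviation K where "K \<equiv> kernel_fun X k"
abbreviation HK where "HK \<equiv> kernel_subspace H ip K"

lemma span_kernel_subset: "A \<subseteq> X \<Longrightarrow> cfun.span (K ` A) \<subseteq> H"
  by (rule cfun.span_minimal[OF _ subspace]) (use kernel_fun_in in auto)

lemma kernel_subspace_iff:
  assumes A: "A \<subseteq> X"
  shows "g \<in> HK A \<longleftrightarrow> g \<in> H \<and>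
    (\<exists>u. (\<forall>n. u n \<in> cfun.span (K ` A)) \<and> (\<lambda>n. hnorm ip (u n - g)) \<longlonglongrightarrow> 0)"
proof -
  interpret M: Metric_space H "hdist H ip" by (rule Metric_space_hdist)
  have sub: "\<And>s. s \<in> cfun.span (K ` A) \<Longrightarrow> s \<in> H" using span_kernel_subset[OF A] by blast
  have *: "g \<in> HK A \<longleftrightarrow> g \<in> H \<and> (\<forall>r>0. \<exists>s\<in>cfun.span (K ` A). hnorm ip (s - g) < r)"
    unfolding kernel_subspace_def M.metric_closure_of
    using sub hnorm_diff_commute by (auto simp: hdist_def M.in_mball)
  show ?thesis
  proof (intro iffI conjI)
    assume g: "g \<in> HK A"
    then have gH: "g \<in> H" and "\<forall>n. \<exists>s\<in>cfun.span (K ` A). hnorm ip (s - g) < inverse (real (Suc n))"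
      using * by auto
    then obtain u where u: "\<And>n. u n \<in> cfun.span (K ` A)"
        "\<And>n. hnorm ip (u n - g) < inverse (real (Suc n))"
      by metis
    have "(\<lambda>n. hnorm ip (u n - g)) \<longlonglongrightarrow> 0"
      by (rule Lim_null_comparison[OF _ LIMSEQ_inverse_real_of_nat])
        (use u sub gH H_diff hnorm_nonneg in \<open>auto intro!: always_eventually less_imp_le\<close>)
    then show "\<exists>u. (\<forall>n. u n \<in> cfun.span (K ` A)) \<and> (\<lambda>n. hnorm ip (u n - g)) \<longlonglongrightarrow> 0"
      using u(1) by blast
    show "g \<in> H" by (rule gH)
  next
    assume R: "g \<in> H \<and> (\<exists>u. (\<forall>n. u n \<in> cfun.span (K ` A)) \<and> (\<lambda>n. hnorm ip (u n - g)) \<longlonglongrightarrow> 0)"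
    then obtain u where u: "\<And>n. u n \<in> cfun.span (K ` A)" "(\<lambda>n. hnorm ip (u n - g)) \<longlonglongrightarrow> 0"
      by blast
    have "\<exists>s\<in>cfun.span (K ` A). hnorm ip (s - g) < r" if "r > 0" for r
      using order_tendstoD(2)[OF u(2) that] u(1) by (auto simp: eventually_sequentially)
    with R show "g \<in> HK A" using * by blast
  qed
qed

lemma kernel_subspace_subset: "A \<subseteq> X \<Longrightarrow> HK A \<subseteq> H"
  by (auto simp: kernel_subspace_iff)

lemma span_kernel_subset_subspace: "A \<subseteq> X \<Longrightarrow> cfun.span (K ` A) \<subseteq> HK A"
proof
  fix s assume A: "A \<subseteq> X" and s: "s \<in> cfun.span (K ` A)"
  then have "s \<in> H" using span_kernel_subset by blast
  moreover have "hnorm ip (s - s) = 0" using ip_zero by (simp add: hnorm_def)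
  ultimately show "s \<in> HK A"
    unfolding kernel_subspace_iff[OF A] using s by (intro conjI exI[of _ "\<lambda>_. s"]) auto
qed

lemma subspace_kernel_subspace:
  assumes A: "A \<subseteq> X"
  shows "cfun.subspace (HK A)"
proof (rule cfun.subspaceI)
  note sub = subsetD[OF span_kernel_subset[OF A]]
  show "0 \<in> HK A" using span_kernel_subset_subspace[OF A] cfun.span_zero by blast
  show "g + h \<in> HK A" if gh: "g \<in> HK A" "h \<in> HK A" for g h
  proof -
    obtain u v where g: "g \<in> H" and h: "h \<in> H"
      and u: "\<And>n. u n \<in> cfun.span (K ` A)" "(\<lambda>n. hnorm ip (u n - g)) \<longlonglongrightarrow> 0"
      and v: "\<And>n. v n \<in> cfun.span (K ` A)" "(\<lambda>n. hnorm ip (v n - h)) \<longlonglongrightarrow> 0"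
      using gh unfolding kernel_subspace_iff[OF A] by blast
    have le: "hnorm ip ((u n + v n) - (g + h)) \<le> hnorm ip (u n - g) + hnorm ip (v n - h)" for n
      using hnorm_triangle[of "u n - g" "v n - h"] sub[OF u(1)] sub[OF v(1)] g h H_diff
      by (simp add: add_diff_add)
    have "(\<lambda>n. hnorm ip ((u n + v n) - (g + h))) \<longlonglongrightarrow> 0"
      by (rule Lim_null_comparison[OF _ tendsto_add_zero[OF u(2) v(2)]])
        (use le sub[OF u(1)] sub[OF v(1)] g h H_diff H_add hnorm_nonneg in auto)
    then show ?thesis
      unfolding kernel_subspace_iff[OF A]
      using H_add[OF g h] u(1) v(1) by (intro conjI exI[of _ "\<lambda>n. u n + v n"]) (blast intro: cfun.span_add)+
  qed
  show "cscale c g \<in> HK A" if gA: "g \<in> HK A" for c g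
  proof -
    obtain u where g: "g \<in> H"
      and u: "\<And>n. u n \<in> cfun.span (K ` A)" "(\<lambda>n. hnorm ip (u n - g)) \<longlonglongrightarrow> 0"
      using gA unfolding kernel_subspace_iff[OF A] by blast
    have "hnorm ip (cscale c (u n) - cscale c g) = cmod c * hnorm ip (u n - g)" for n
      using hnorm_scale[of "u n - g" c] sub[OF u(1)] g H_diff
      by (simp add: cfun.scale_right_diff_distrib)
    then have "(\<lambda>n. hnorm ip (cscale c (u n) - cscale c g)) \<longlonglongrightarrow> 0"
      using tendsto_mult_right_zero[OF u(2), of "cmod c"] by (simp only:)
    then show ?thesis
      unfolding kernel_subspace_iff[OF A]
      using H_scale[OF g, of c] u(1) by (intro conjI exI[of _ "\<lambda>n. cscale c (u n)"]) (blast intro: cfun.span_scale)+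
  qed
qed

text \<open>By the reproducing property, vanishing on \<open>A\<close> means orthogonality to the
  span that approximates \<open>g\<close>. This makes a map into a kernel subspace definable by
  prescribing values.\<close>

lemma kernel_subspace_eq_0:
  assumes A: "A \<subseteq> X" and g: "g \<in> HK A" and z: "\<And>a. a \<in> A \<Longrightarrow> g a = 0"
  shows "g = 0"
proof (rule ccontr)
  assume "g \<noteq> 0"
  have gH: "g \<in> H" using g kernel_subspace_subset[OF A] by blast
  with \<open>g \<noteq> 0\<close> have pos: "hnorm ip g > 0"
    using hnorm_eq_0_iff hnorm_nonneg by (metis less_eq_real_def)
  have "cfun.subspace {s \<in> H. ip g s = 0}"
    using gH ip_scale_right[of g 0 0] cfun.subspace_0[OF subspace]
    by (intro cfun.subspaceI) (auto simp: H_add H_scale ip_add_right ip_scale_right)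
  moreover have "K ` A \<subseteq> {s \<in> H. ip g s = 0}"
    using A z gH by (auto simp: reproducing kernel_fun_in subset_iff)
  ultimately have orth: "cfun.span (K ` A) \<subseteq> {s \<in> H. ip g s = 0}"
    by (rule cfun.span_minimal[rotated])
  obtain u where u: "\<And>n. u n \<in> cfun.span (K ` A)" and lim: "(\<lambda>n. hnorm ip (u n - g)) \<longlonglongrightarrow> 0"
    using g unfolding kernel_subspace_iff[OF A] by blast
  \<comment> \<open>One approximant closer than the norm of \<open>g\<close> suffices: being
    orthogonal to \<open>g\<close>, it gives
    \<open>(hnorm ip g)\<^sup>2 = Re (ip g (g - u n))\<close>, which Cauchy-Schwarz makes too
    small.\<close>
  obtain n where n: "hnorm ip (u n - g) < hnorm ip g"
    using order_tendstoD(2)[OF lim pos] by (auto simp: eventually_sequentially)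
  have un: "u n \<in> H" "ip g (u n) = 0" using u orth by auto
  have "(hnorm ip g)\<^sup>2 = Re (ip g (g - u n))"
    using un gH by (simp add: ip_diff_right hnorm_power2)
  also have "\<dots> \<le> hnorm ip g * hnorm ip (u n - g)"
    using Re_ip_le[of g "g - u n"] un gH H_diff hnorm_diff_commute by metis
  also have "\<dots> < (hnorm ip g)\<^sup>2"
    using n pos by (simp add: power2_eq_square)
  finally show False by simp
qed

text \<open>Preservation of norms would not be stable under sums. The inner product condition
  against every pair \<open>g'\<close>, \<open>h'\<close> linked by the same equation is linear in
  the transferred pair, so it only has to be checked on kernel functions.\<close>

lemma span_kernel_transfer:
  assumes A: "A \<subseteq> X" and B: "B \<subseteq> X" and \<phi>: "\<phi> ` A \<subseteq> B"
    and f: "\<And>a. a \<in> A \<Longrightarrow> f a \<noteq> 0"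
    and gram: "\<And>a b. \<lbrakk>a \<in> A; b \<in> A\<rbrakk> \<Longrightarrow> k (\<phi> a) (\<phi> b) = f a * cnj (f b) * k a b"
    and g: "g \<in> cfun.span (K ` A)"
  shows "\<exists>h\<in>cfun.span (K ` B). (\<forall>x\<in>A. h (\<phi> x) = f x * g x) \<and>
    (\<forall>g'\<in>H. \<forall>h'\<in>H. (\<forall>x\<in>A. h' (\<phi> x) = f x * g' x) \<longrightarrow> ip h' h = ip g' g)"
    (is "?P g")
proof -
  have "cfun.subspace (Collect (\<lambda>g. g \<in> H \<and> ?P g))"
  proof (rule cfun.subspaceI)
    have "ip h' 0 = 0" if "h' \<in> H" for h'
      using ip_scale_right[of h' h' 0] that by simp
    then show "0 \<in> Collect (\<lambda>g. g \<in> H \<and> ?P g)"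
      using cfun.subspace_0[OF subspace] by (auto intro!: bexI[of _ 0] cfun.span_zero)
  next
    fix g1 g2 assume "g1 \<in> Collect (\<lambda>g. g \<in> H \<and> ?P g)" "g2 \<in> Collect (\<lambda>g. g \<in> H \<and> ?P g)"
    then obtain h1 h2 where g: "g1 \<in> H" "g2 \<in> H" and h: "h1 \<in> cfun.span (K ` B)" "h2 \<in> cfun.span (K ` B)"
      and e: "\<forall>x\<in>A. h1 (\<phi> x) = f x * g1 x" "\<forall>x\<in>A. h2 (\<phi> x) = f x * g2 x"
      and i: "\<forall>g'\<in>H. \<forall>h'\<in>H. (\<forall>x\<in>A. h' (\<phi> x) = f x * g' x) \<longrightarrow> ip h' h1 = ip g' g1"
        "\<forall>g'\<in>H. \<forall>h'\<in>H. (\<forall>x\<in>A. h' (\<phi> x) = f x * g' x) \<longrightarrow> ip h' h2 = ip g' g2"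
      by blast
    have "h1 \<in> H" "h2 \<in> H" using h span_kernel_subset[OF B] by auto
    with g i have "\<forall>g'\<in>H. \<forall>h'\<in>H. (\<forall>x\<in>A. h' (\<phi> x) = f x * g' x) \<longrightarrow> ip h' (h1 + h2) = ip g' (g1 + g2)"
      by (simp add: ip_add_right)
    moreover have "\<forall>x\<in>A. (h1 + h2) (\<phi> x) = f x * (g1 + g2) x"
      using e by (simp add: distrib_left)
    ultimately show "g1 + g2 \<in> Collect (\<lambda>g. g \<in> H \<and> ?P g)"
      using cfun.span_add[OF h] H_add[OF g] by blast
  next
    fix c g assume "g \<in> Collect (\<lambda>g. g \<in> H \<and> ?P g)"
    then obtain h where g: "g \<in> H" and h: "h \<in> cfun.span (K ` B)"
      and e: "\<forall>x\<in>A. h (\<phi> x) = f x * g x"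
      and i: "\<forall>g'\<in>H. \<forall>h'\<in>H. (\<forall>x\<in>A. h' (\<phi> x) = f x * g' x) \<longrightarrow> ip h' h = ip g' g"
      by blast
    have "h \<in> H" using h span_kernel_subset[OF B] by auto
    with g i have "\<forall>g'\<in>H. \<forall>h'\<in>H. (\<forall>x\<in>A. h' (\<phi> x) = f x * g' x) \<longrightarrow> ip h' (cscale c h) = ip g' (cscale c g)"
      by (simp add: ip_scale_right)
    moreover have "\<forall>x\<in>A. cscale c h (\<phi> x) = f x * cscale c g x"
      using e by (simp add: cscale_def)
    ultimately show "cscale c g \<in> Collect (\<lambda>g. g \<in> H \<and> ?P g)"
      using cfun.span_scale[OF h] H_scale[OF g] by blast
  qed
  moreover have "K ` A \<subseteq> Collect (\<lambda>g. g \<in> H \<and> ?P g)"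
  proof (clarify, intro conjI)
    fix a assume a: "a \<in> A"
    show Ka: "K a \<in> H" using a A kernel_fun_in by blast
    have \<phi>a: "\<phi> a \<in> X" "K (\<phi> a) \<in> H" using a \<phi> B kernel_fun_in by auto
    \<comment> \<open>The conjugate inverse cancels \<open>cnj (f a)\<close> in the Gram relation;
      in the second slot of \<open>ip\<close> it becomes \<open>inverse (f a)\<close>, which cancels
      the weight in \<open>h' (\<phi> a) = f a * g' a\<close>.\<close>
    define h where "h = cscale (inverse (cnj (f a))) (K (\<phi> a))"
    have "h \<in> cfun.span (K ` B)"
      unfolding h_def using a \<phi> by (intro cfun.span_scale cfun.span_base) auto
    moreover have "\<forall>x\<in>A. h (\<phi> x) = f x * K a x"
    proof
      fix x assume x: "x \<in> A"
      then have "x \<in> X" "\<phi> x \<in> X" using A B \<phi> by auto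
      then show "h (\<phi> x) = f x * K a x"
        using gram[OF x a] f[OF a] by (simp add: h_def cscale_def kernel_fun_def)
    qed
    moreover have "ip h' h = ip g' (K a)"
      if g': "g' \<in> H" and h': "h' \<in> H" and e: "\<forall>x\<in>A. h' (\<phi> x) = f x * g' x" for g' h'
    proof -
      have "a \<in> X" using a A by blast
      with g' h' e a f[OF a] \<phi>a show ?thesis
        by (simp add: h_def ip_scale_right reproducing)
    qed
    ultimately show "?P (K a)" by blast
  qed
  ultimately have "cfun.span (K ` A) \<subseteq> Collect (\<lambda>g. g \<in> H \<and> ?P g)"
    by (rule cfun.span_minimal[rotated])
  with g show ?thesis by blast
qed

text \<open>Approximants of \<open>g\<close> are transferred one by one. Their images are Cauchy
  because norms of differences survive, and completeness provides the limit
  \<open>h\<close>.\<close>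

lemma kernel_subspace_transfer:
  assumes A: "A \<subseteq> X" and B: "B \<subseteq> X" and \<phi>: "\<phi> ` A \<subseteq> B"
    and f: "\<And>a. a \<in> A \<Longrightarrow> f a \<noteq> 0"
    and gram: "\<And>a b. \<lbrakk>a \<in> A; b \<in> A\<rbrakk> \<Longrightarrow> k (\<phi> a) (\<phi> b) = f a * cnj (f b) * k a b"
    and g: "g \<in> HK A"
  shows "\<exists>h\<in>HK B. (\<forall>x\<in>A. h (\<phi> x) = f x * g x) \<and> hnorm ip h = hnorm ip g"
proof -
  note subA = subsetD[OF span_kernel_subset[OF A]] and subB = subsetD[OF span_kernel_subset[OF B]]
  obtain u where gH: "g \<in> H" and u: "\<And>n. u n \<in> cfun.span (K ` A)"
    and ulim: "(\<lambda>n. hnorm ip (u n - g)) \<longlonglongrightarrow> 0"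
    using g unfolding kernel_subspace_iff[OF A] by blast
  have "\<forall>n. \<exists>h. h \<in> cfun.span (K ` B) \<and> (\<forall>x\<in>A. h (\<phi> x) = f x * u n x) \<and>
    (\<forall>g'\<in>H. \<forall>h'\<in>H. (\<forall>x\<in>A. h' (\<phi> x) = f x * g' x) \<longrightarrow> ip h' h = ip g' (u n))"
    using span_kernel_transfer[OF A B \<phi> f gram u] by blast
  then obtain v where v: "\<And>n. v n \<in> cfun.span (K ` B)"
    and ev: "\<And>n x. x \<in> A \<Longrightarrow> v n (\<phi> x) = f x * u n x"
    and iv: "\<And>n g' h'. \<lbrakk>g' \<in> H; h' \<in> H; \<forall>x\<in>A. h' (\<phi> x) = f x * g' x\<rbrakk> \<Longrightarrow> ip h' (v n) = ip g' (u n)"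
    by metis
  note uH = subA[OF u] and vH = subB[OF v]
  have "ip (v m - v n) (v m - v n) = ip (u m - u n) (u m - u n)" for m n
  proof -
    \<comment> \<open>The \<open>v n\<close> are chosen independently, but a difference of linked
      pairs is again linked, so it can be tested against \<open>v m\<close> and \<open>v n\<close>
      separately.\<close>
    have "\<forall>x\<in>A. (v m - v n) (\<phi> x) = f x * (u m - u n) x"
      using ev by (simp add: right_diff_distrib)
    then have "ip (v m - v n) (v l) = ip (u m - u n) (u l)" for l
      using iv[of "u m - u n" "v m - v n"] uH vH H_diff by blast
    then show ?thesis using uH vH H_diff by (simp add: ip_diff_right)
  qed
  then have nd: "hnorm ip (v m - v n) = hnorm ip (u m - u n)" for m n
    by (simp add: hnorm_def)
  have "\<exists>N. \<forall>m\<ge>N. \<forall>n\<ge>N. hnorm ip (v m - v n) < e" if e: "e > 0" for e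
  proof -
    obtain N where N: "\<And>n. n \<ge> N \<Longrightarrow> hnorm ip (u n - g) < e / 2"
      using order_tendstoD(2)[OF ulim half_gt_zero[OF e]]
      unfolding eventually_sequentially by blast
    have "hnorm ip (u m - u n) < e" if "m \<ge> N" "n \<ge> N" for m n
      using hnorm_triangle[of "u m - g" "g - u n"] N[OF that(1)] N[OF that(2)] uH gH H_diff
        hnorm_diff_commute[of g "u n"] by simp
    then show ?thesis unfolding nd by blast
  qed
  then obtain h where hH: "h \<in> H" and vlim: "(\<lambda>n. hnorm ip (v n - h)) \<longlonglongrightarrow> 0"
    using Cauchy_imp_tendsto[of v] vH by blast
  have "h \<in> HK B" unfolding kernel_subspace_iff[OF B] using hH v vlim by blast
  moreover have "h (\<phi> x) = f x * g x" if x: "x \<in> A" for x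
  proof (rule LIMSEQ_unique)
    show "(\<lambda>n. v n (\<phi> x)) \<longlonglongrightarrow> h (\<phi> x)"
      by (rule tendsto_eval[OF vH hH vlim]) (use x \<phi> B in auto)
    show "(\<lambda>n. v n (\<phi> x)) \<longlonglongrightarrow> f x * g x"
      unfolding ev[OF x]
      by (intro tendsto_mult_left tendsto_eval[OF uH gH ulim]) (use x A in auto)
  qed
  moreover have "hnorm ip h = hnorm ip g"
  proof (rule LIMSEQ_unique)
    show "(\<lambda>n. hnorm ip (v n)) \<longlonglongrightarrow> hnorm ip h" by (rule tendsto_hnorm[OF vH hH vlim])
    have "hnorm ip (v n) = hnorm ip (u n)" for n
      using iv[OF uH vH, of n n] ev iv[of "u n" "v n" n] uH vH by (simp add: hnorm_def)
    then show "(\<lambda>n. hnorm ip (v n)) \<longlonglongrightarrow> hnorm ip g"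
      using tendsto_hnorm[OF uH gH ulim] by simp
  qed
  ultimately show ?thesis by blast
qed

text \<open>\<open>T\<close> is the weighted change of variables
  \<open>T g (\<phi> x) = f x * g x\<close>. Linearity is read off from values on
  \<open>B\<close>.\<close>

lemma isometric_kernel_subspacesI:
  assumes A: "A \<subseteq> X" and B: "B \<subseteq> X" and \<phi>: "bij_betw \<phi> A B"
    and f: "\<And>a. a \<in> A \<Longrightarrow> f a \<noteq> 0"
    and gram: "\<And>a b. \<lbrakk>a \<in> A; b \<in> A\<rbrakk> \<Longrightarrow> k (\<phi> a) (\<phi> b) = f a * cnj (f b) * k a b"
  shows "isometric_kernel_subspaces H ip K A B"
proof -
  define R where "R = (\<lambda>g h. h \<in> HK B \<and> (\<forall>x\<in>A. h (\<phi> x) = f x * g x))"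
  define T where "T g = (THE h. R g h)" for g
  have im: "\<phi> ` A = B" using \<phi> by (simp add: bij_betw_def)
  note subA = subspace_kernel_subspace[OF A] and subB = subspace_kernel_subspace[OF B]
  have uniq: "h = h'" if "R g h" "R g h'" for g h h'
  proof -
    have "h - h' \<in> HK B" using that cfun.subspace_diff[OF subB] by (auto simp: R_def)
    moreover have "(h - h') b = 0" if "b \<in> B" for b
      using \<open>R g h\<close> \<open>R g h'\<close> that im by (auto simp: R_def)
    ultimately have "h - h' = 0" using kernel_subspace_eq_0[OF B] by blast
    then show ?thesis by simp
  qed
  have TI: "T g = h" if "R g h" for g h
    unfolding T_def using that uniq by blast
  have RT: "R g (T g)" and nT: "hnorm ip (T g) = hnorm ip g" if g: "g \<in> HK A" for g
  proof -
    obtain h where "R g h" "hnorm ip h = hnorm ip g"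
      using kernel_subspace_transfer[OF A B equalityD1[OF im] f gram g] unfolding R_def by blast
    then show "R g (T g)" "hnorm ip (T g) = hnorm ip g" using TI by auto
  qed
  have "\<exists>g\<in>HK A. R g h" if h: "h \<in> HK B" for h
  proof -
    define \<psi> where "\<psi> = inv_into A \<phi>"
    have \<psi>: "\<psi> b \<in> A" "\<phi> (\<psi> b) = b" if "b \<in> B" for b
      using that im by (auto simp: \<psi>_def inv_into_into f_inv_into_f)
    have \<psi>\<phi>: "\<psi> (\<phi> a) = a" if "a \<in> A" for a
      using that \<phi> by (simp add: \<psi>_def bij_betw_inv_into_left)
    \<comment> \<open>Surjectivity is the same transfer backwards, along the inverse bijection and
      with inverse weights.\<close>
    have "\<exists>g\<in>HK A. (\<forall>x\<in>B. g (\<psi> x) = inverse (f (\<psi> x)) * h x) \<and> hnorm ip g = hnorm ip h"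
    proof (rule kernel_subspace_transfer[OF B A _ _ _ h])
      show "\<psi> ` B \<subseteq> A" using \<psi> by blast
      show "inverse (f (\<psi> b)) \<noteq> 0" if "b \<in> B" for b using f \<psi> that by simp
      show "k (\<psi> a) (\<psi> b) = inverse (f (\<psi> a)) * cnj (inverse (f (\<psi> b))) * k a b"
        if "a \<in> B" "b \<in> B" for a b
        using gram[OF \<psi>(1)[OF that(1)] \<psi>(1)[OF that(2)]] f[OF \<psi>(1)[OF that(1)]]
          f[OF \<psi>(1)[OF that(2)]] by (simp add: \<psi>(2) that field_simps)
    qed
    then obtain g where g: "g \<in> HK A" "\<And>x. x \<in> B \<Longrightarrow> g (\<psi> x) = inverse (f (\<psi> x)) * h x" by blast
    have "h (\<phi> x) = f x * g x" if x: "x \<in> A" for x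
      using g(2)[of "\<phi> x"] x f im by (auto simp: \<psi>\<phi>)
    with g h show ?thesis by (auto simp: R_def)
  qed
  then have "T ` HK A = HK B" using RT TI by (fastforce simp: R_def)
  moreover have "T (g + h) = T g + T h" if "g \<in> HK A" "h \<in> HK A" for g h
    by (rule TI) (use RT[OF that(1)] RT[OF that(2)] cfun.subspace_add[OF subB] in
        \<open>auto simp: R_def distrib_left\<close>)
  moreover have "T (cscale c g) = cscale c (T g)" if "g \<in> HK A" for c g
    by (rule TI) (use RT[OF that] cfun.subspace_scale[OF subB] in \<open>auto simp: R_def cscale_def\<close>)
  moreover have "T (K a) = cscale (inverse (cnj (f a))) (K (\<phi> a))" if a: "a \<in> A" for a
  proof (rule TI)
    have "cscale (inverse (cnj (f a))) (K (\<phi> a)) \<in> cfun.span (K ` B)"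
      using a im by (intro cfun.span_scale cfun.span_base) auto
    moreover have "cscale (inverse (cnj (f a))) (K (\<phi> a)) (\<phi> x) = f x * K a x" if x: "x \<in> A" for x
    proof -
      have "x \<in> X" "\<phi> x \<in> X" using x A B im by auto
      then show ?thesis
        using gram[OF x a] f[OF a] by (simp add: cscale_def kernel_fun_def)
    qed
    ultimately show "R (K a) (cscale (inverse (cnj (f a))) (K (\<phi> a)))"
      using span_kernel_subset_subspace[OF B] by (auto simp: R_def)
  qed
  ultimately show ?thesis
    unfolding isometric_kernel_subspaces_def using \<phi> nT
    by (intro exI[of _ T] exI[of _ \<phi>] exI[of _ "\<lambda>a. inverse (cnj (f a))"]) blast
qed

text \<open>\<open>T\<close> preserves inner products of kernel functions, which are kernel values.
  The nonzero diagonal rules out vanishing multipliers.\<close>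

lemma isometric_kernel_subspacesD:
  assumes A: "A \<subseteq> X" and B: "B \<subseteq> X" and nz: "\<And>a. a \<in> A \<Longrightarrow> k a a \<noteq> 0"
    and iso: "isometric_kernel_subspaces H ip K A B"
  obtains \<phi> f where "bij_betw \<phi> A B" "\<And>a. a \<in> A \<Longrightarrow> f a \<noteq> 0"
    "\<And>a b. \<lbrakk>a \<in> A; b \<in> A\<rbrakk> \<Longrightarrow> k (\<phi> a) (\<phi> b) = f a * cnj (f b) * k a b"
proof -
  obtain T \<phi> f where T: "T ` HK A = HK B"
    and add: "\<forall>g\<in>HK A. \<forall>h\<in>HK A. T (g + h) = T g + T h"
    and scale: "\<forall>c. \<forall>g\<in>HK A. T (cscale c g) = cscale c (T g)"
    and nrm: "\<forall>g\<in>HK A. hnorm ip (T g) = hnorm ip g"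
    and \<phi>: "bij_betw \<phi> A B" and TK: "\<forall>a\<in>A. T (K a) = cscale (f a) (K (\<phi> a))"
    using iso unfolding isometric_kernel_subspaces_def by (elim exE conjE) (rule that, assumption+)
  have KA: "K a \<in> HK A" if "a \<in> A" for a
    by (rule subsetD[OF span_kernel_subset_subspace[OF A] cfun.span_base[OF imageI[OF that]]])
  have TH: "T g \<in> H" if "g \<in> HK A" for g
    using that T imageI[of g "HK A" T] kernel_subspace_subset[OF B] by auto
  \<comment> \<open>\<open>ip (K a) (K b)\<close> is the value of \<open>K a\<close> at
    \<open>b\<close>, hence the exchanged arguments.\<close>
  have gram: "k b a = f a * cnj (f b) * k (\<phi> b) (\<phi> a)" if "a \<in> A" "b \<in> A" for a b
  proof -
    have X: "a \<in> X" "b \<in> X" "\<phi> a \<in> X" "\<phi> b \<in> X" using that A B \<phi> by (auto simp: bij_betw_def)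
    have "ip (T (K a)) (T (K b)) = ip (K a) (K b)"
      by (rule ip_eq_if_hnorm_eq[OF subspace_kernel_subspace[OF A] kernel_subspace_subset[OF A] TH
            add[rule_format] scale[rule_format] nrm[rule_format] KA[OF that(1)] KA[OF that(2)]])
    then show ?thesis
      using that X kernel_fun_in
      by (simp add: TK ip_scale_left ip_scale_right H_scale reproducing)
        (simp add: kernel_fun_def cscale_def mult_ac)
  qed
  have f: "f a \<noteq> 0" if "a \<in> A" for a
    using gram[OF that that] nz[OF that] by auto
  show ?thesis
  \<comment> \<open>Solving for the image kernel inverts the multiplier; exchanging the arguments
    back conjugates it.\<close>
  proof (rule that[OF \<phi>, of "\<lambda>a. inverse (cnj (f a))"])
    show "inverse (cnj (f a)) \<noteq> 0" if "a \<in> A" for a using f[OF that] by simp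
    show "k (\<phi> a) (\<phi> b) = inverse (cnj (f a)) * cnj (inverse (cnj (f b))) * k a b"
      if "a \<in> A" "b \<in> A" for a b
      using gram[OF that(2,1)] f[OF that(1)] f[OF that(2)] by (simp add: field_simps)
  qed
qed

end

section \<open>The kernel of the ball\<close>

lemma abs_Im_Ln_less:
  assumes "Re z > 0"
  shows "\<bar>Im (Ln z)\<bar> < pi / 2"
proof -
  have "z \<noteq> 0" using assms by auto
  with assms show ?thesis using Re_Ln_pos_lt by blast
qed

text \<open>All arguments lie in \<open>(-\<pi>/2, \<pi>/2)\<close>, so the logarithms of the two sides cannot differ by a
  nonzero multiple of \<open>2\<pi>i\<close>.\<close>

lemma powr_mult_right_half_plane:
  fixes t :: real
  assumes pos: "Re w > 0" "Re u > 0" "Re v > 0" "Re z > 0" "c > 0"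
    and eq: "w * u * v = of_real c * z"
  shows "w powr t * u powr t * v powr t = of_real (c powr t) * z powr t"
proof -
  have nz: "w \<noteq> 0" "u \<noteq> 0" "v \<noteq> 0" "z \<noteq> 0" using pos by auto
  have "exp (Ln w + Ln u + Ln v) = exp (of_real (ln c) + Ln z)"
    using nz eq exp_of_real[of "ln c", where 'a = complex] \<open>c > 0\<close> by (simp add: exp_add)
  moreover have "\<bar>Im (Ln w + Ln u + Ln v) - Im (of_real (ln c) + Ln z)\<bar> < 2 * pi"
    using abs_Im_Ln_less[OF pos(1)] abs_Im_Ln_less[OF pos(2)] abs_Im_Ln_less[OF pos(3)]
      abs_Im_Ln_less[OF pos(4)] by simp
  ultimately have ln: "Ln w + Ln u + Ln v = of_real (ln c) + Ln z"
    by (rule exp_complex_eqI[rotated])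
  have "w powr t * u powr t * v powr t = exp (of_real t * (Ln w + Ln u + Ln v))"
    using nz by (simp add: powr_def exp_add distrib_left)
  also have "\<dots> = exp (of_real (t * ln c)) * exp (of_real t * Ln z)"
    unfolding ln by (simp add: exp_add distrib_left)
  also have "\<dots> = of_real (c powr t) * z powr t"
    using nz \<open>c > 0\<close> exp_of_real[of "t * ln c", where 'a = complex] by (simp add: powr_def)
  finally show ?thesis .
qed

text \<open>For \<open>t \<le> 2\<close> the numbers \<open>t * Ln z\<close> have imaginary part in
  (-pi, pi), where \<open>exp\<close> is injective.\<close>

lemma powr_inj_right_half_plane:
  fixes t :: real
  assumes t: "0 < t" "t \<le> 2" and pos: "Re z > 0" "Re w > 0"
    and eq: "z powr t = w powr t"
  shows "z = w"
proof -
  have nz: "z \<noteq> 0" "w \<noteq> 0" using pos by auto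
  have small: "\<bar>Im (of_real t * Ln u)\<bar> < pi" if "Re u > 0" for u
  proof -
    have "t * \<bar>Im (Ln u)\<bar> \<le> 2 * \<bar>Im (Ln u)\<bar>"
      using t by (intro mult_right_mono) auto
    then show ?thesis using abs_Im_Ln_less[OF that] t by (simp add: abs_mult)
  qed
  have "exp (of_real t * Ln z) = exp (of_real t * Ln w)"
    using eq nz by (simp add: powr_def)
  then have "of_real t * Ln z = of_real t * Ln w"
    by (rule exp_complex_eqI[rotated]) (use small[OF pos(1)] small[OF pos(2)] in linarith)
  then show ?thesis using t nz by (metis exp_Ln mult_left_cancel of_real_eq_0_iff less_irrefl)
qed

text \<open>The Moebius identity for \<open>F\<close>, raised to the power \<open>t\<close>. Its
  denominator has one factor depending on \<open>x\<close> and one on \<open>y\<close>, which are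
  conjugate in form.\<close>

lemma automorphism_ball_kernel:
  fixes F :: "complex ^ 'd \<Rightarrow> complex ^ 'd"
  assumes F: "biholomorphic_automorphism (ball 0 1) F"
  obtains f where "\<And>x. x \<in> ball 0 1 \<Longrightarrow> f x \<noteq> 0"
    "\<And>x y. \<lbrakk>x \<in> ball 0 1; y \<in> ball 0 1\<rbrakk> \<Longrightarrow>
       ball_kernel t (F x) (F y) = f x * cnj (f y) * ball_kernel t x y"
proof -
  obtain a where a: "a \<in> ball 0 1"
    and id: "\<And>x y. \<lbrakk>x \<in> ball 0 1; y \<in> ball 0 1\<rbrakk> \<Longrightarrow> 1 - cinner_vec (F x) (F y) =
       of_real (1 - (norm a)\<^sup>2) * (1 - cinner_vec x y) / ((1 - cinner_vec x a) * (1 - cinner_vec a y))"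
    by (rule automorphism_cinner[OF F]) (rule that; assumption)
  have FB: "F x \<in> ball 0 1" if "x \<in> ball 0 1" for x
    using F that by (metis biholomorphic_automorphism_def bij_betw_apply)
  define c where "c = 1 - (norm a)\<^sup>2"
  have c: "c > 0" using a by (simp add: c_def power_less_one_iff)
  \<comment> \<open>The constant \<open>c powr t\<close> is shared equally between
    \<open>f x\<close> and \<open>cnj (f y)\<close>.\<close>
  define f where "f = (\<lambda>x. (1 - cinner_vec x a) powr t / of_real (sqrt (c powr t)))"
  have sq: "complex_of_real (sqrt (c powr t)) * of_real (sqrt (c powr t)) = of_real (c powr t)"
    using c by (simp flip: of_real_mult)
  have nz: "1 - cinner_vec x a \<noteq> 0" if "x \<in> ball 0 1" for x
    using one_minus_cinner_vec_nonzero[OF that a] .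
  show ?thesis
  proof (rule that)
    show "f x \<noteq> 0" if "x \<in> ball 0 1" for x
      using nz[OF that] c by (simp add: f_def)
    fix x y :: "complex ^ 'd" assume x: "x \<in> ball 0 1" and y: "y \<in> ball 0 1"
    note Re_pos = Re_one_minus_cinner_vec_pos
    \<comment> \<open>Conjugation commutes with the principal power off the negative axis, here
      because the real part is positive.\<close>
    have "cnj ((1 - cinner_vec y a) powr t) = cnj (1 - cinner_vec y a) powr cnj t"
      using Re_pos[OF y a] by (intro cnj_powr) auto
    then have cnj_f: "cnj (f y) = (1 - cinner_vec a y) powr t / of_real (sqrt (c powr t))"
      by (simp add: f_def cnj_cinner_vec)
    have cancel: "v / (p * q) * p * q = v" if "p \<noteq> 0" "q \<noteq> 0" for v p q :: complex
      using that by simp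
    have "(1 - cinner_vec (F x) (F y)) * (1 - cinner_vec x a) * (1 - cinner_vec a y)
        = of_real c * (1 - cinner_vec x y)"
      unfolding id[OF x y] c_def[symmetric]
      using cancel[OF nz[OF x] one_minus_cinner_vec_nonzero[OF a y]] .
    then have "(1 - cinner_vec (F x) (F y)) powr t * (1 - cinner_vec x a) powr t
        * (1 - cinner_vec a y) powr t = of_real (c powr t) * (1 - cinner_vec x y) powr t"
      by (intro powr_mult_right_half_plane Re_pos FB x y a c)
    then have "(1 - cinner_vec (F x) (F y)) powr t * (f x * cnj (f y)) = (1 - cinner_vec x y) powr t"
      using c sq by (simp add: cnj_f) (simp add: f_def field_simps)
    moreover have "(1 - cinner_vec (F x) (F y)) powr t \<noteq> 0" "(1 - cinner_vec x y) powr t \<noteq> 0"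
      using one_minus_cinner_vec_nonzero[OF x y] one_minus_cinner_vec_nonzero[OF FB[OF x] FB[OF y]]
      by simp_all
    ultimately show "ball_kernel t (F x) (F y) = f x * cnj (f y) * ball_kernel t x y"
      by (simp add: ball_kernel_def field_simps)
  qed
qed

lemma ball_kernel_nonzero:
  "\<lbrakk>x \<in> ball 0 1; y \<in> ball 0 1\<rbrakk> \<Longrightarrow> ball_kernel t x y \<noteq> 0"
  using one_minus_cinner_vec_nonzero[of x y] by (simp add: ball_kernel_def)

section \<open>Extension to a unitary map\<close>

text \<open>\<open>U\<close> is prescribed on a maximal independent subset. At any other
  \<open>a\<close> in \<open>A\<close>, the squared norm of \<open>U a - \<phi> a\<close> expands
  into inner products that cancel. Off the span of \<open>A\<close> the extension is
  arbitrary.\<close>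

lemma gram_linear_extension:
  fixes \<phi> :: "complex ^ 'd \<Rightarrow> complex ^ 'd"
  assumes gram: "\<And>a b. \<lbrakk>a \<in> A; b \<in> A\<rbrakk> \<Longrightarrow> cinner_vec (\<phi> a) (\<phi> b) = cinner_vec a b"
  obtains U where "Vector_Spaces.linear (*s) (*s) U" "\<And>a. a \<in> A \<Longrightarrow> U a = \<phi> a"
    "\<And>x. x \<in> vec.span A \<Longrightarrow> norm (U x) = norm x"
proof -
  obtain S where S: "S \<subseteq> A" "vec.independent S" "A \<subseteq> vec.span S"
    using vec.maximal_independent_subset by blast
  obtain U where lin: "Vector_Spaces.linear (*s) (*s) U" and US: "\<And>x. x \<in> S \<Longrightarrow> U x = \<phi> x"
    using vec.linear_independent_extend[OF S(2), of \<phi>] by blast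
  interpret U: Vector_Spaces.linear "(*s)" "(*s)" U by (rule lin)
  \<comment> \<open>The arguments pass to the span one at a time: first against
    \<open>\<phi> b\<close>, then against \<open>U y\<close>.\<close>
  have U1: "cinner_vec (U x) (\<phi> b) = cinner_vec x b" if "x \<in> vec.span S" "b \<in> A" for x b
    using that(1)
  proof (induction rule: vec.span_induct_alt)
    case base then show ?case by (simp add: U.zero)
  next
    case (step c x y)
    then show ?case
      using gram[of x b] S(1) that(2) by (auto simp: U.add U.scale US cinner_vec_simps)
  qed
  have U2: "cinner_vec (U x) (U y) = cinner_vec x y" if "x \<in> vec.span S" "y \<in> vec.span S" for x y
    using that(2)
  proof (induction rule: vec.span_induct_alt)
    case base then show ?case by (simp add: U.zero)
  next
    case (step c z y)
    then show ?case
      using U1[OF that(1), of z] S(1) by (auto simp: U.add U.scale US cinner_vec_simps)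
  qed
  have "U a = \<phi> a" if a: "a \<in> A" for a
  proof -
    have aS: "a \<in> vec.span S" using a S by blast
    have aU: "cinner_vec (U a) (\<phi> a) = cinner_vec a a" using U1[OF aS a] .
    then have "cinner_vec (\<phi> a) (U a) = cinner_vec a a"
      by (metis cnj_cinner_vec)
    with aU have "cinner_vec (U a - \<phi> a) (U a - \<phi> a) = 0"
      using gram[OF a a] U2[OF aS aS] by (simp add: cinner_vec_simps)
    then show ?thesis by (simp add: cinner_vec_self)
  qed
  moreover have "norm (U x) = norm x" if "x \<in> vec.span A" for x
  proof -
    have "x \<in> vec.span S"
      using that S(3) vec.span_minimal[OF S(3) vec.subspace_span] by blast
    from U2[OF this this] have "(norm (U x))\<^sup>2 = (norm x)\<^sup>2"
      unfolding cinner_vec_self of_real_eq_iff .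
    then show ?thesis by simp
  qed
  ultimately show ?thesis using lin that by blast
qed

text \<open>A vector real-orthogonal to a complex subspace is complex-orthogonal to it, as the
  subspace contains \<open>\<i> *s a\<close> along with \<open>a\<close>.\<close>

lemma unit_vector_orthogonal_to_proper_subspace:
  fixes A :: "(complex ^ 'd) set"
  assumes "vec.dim A < CARD('d)"
  obtains u where "norm u = 1" "\<And>a. a \<in> A \<Longrightarrow> cinner_vec u a = 0"
proof -
  have ne: "vec.span A \<noteq> UNIV"
    using assms vec_dim_card[where 'a = complex and 'n = 'd] by (metis nat_less_le vec.dim_span)
  have sub: "subspace (vec.span A)"
    by (auto simp: subspace_def scaleR_eq_vector_smult vec.span_zero vec.span_add vec.span_scale)
  have "span (vec.span A) \<subset> span UNIV"
    using ne sub by (simp add: span_eq_iff[THEN iffD2] psubset_eq)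
  then obtain x where x: "x \<noteq> 0" and orth: "\<And>y. y \<in> span (vec.span A) \<Longrightarrow> orthogonal x y"
    by (rule orthogonal_to_subspace_exists_gen) blast
  have re: "Re (cinner_vec x y) = 0" if "y \<in> vec.span A" for y
    using orth[of y] that by (simp add: Re_cinner_vec orthogonal_def span_base)
  have z: "cinner_vec x a = 0" if "a \<in> A" for a
  proof -
    have "a \<in> vec.span A" using that by (rule vec.span_base)
    with re[OF this] re[OF vec.span_scale[OF this, of \<i>]] show ?thesis
      by (simp add: cinner_vec_simps complex_eq_iff)
  qed
  show ?thesis
    by (rule that[of "of_real (inverse (norm x)) *s x"])
      (use x z in \<open>simp_all add: norm_vector_smult norm_inverse cinner_vec_simps\<close>)
qed

lemma gram_unitary_extension:
  fixes \<phi> :: "complex ^ 'd \<Rightarrow> complex ^ 'd"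
  assumes gram: "\<And>a b. \<lbrakk>a \<in> A; b \<in> A\<rbrakk> \<Longrightarrow> cinner_vec (\<phi> a) (\<phi> b) = cinner_vec a b"
  obtains U where "Vector_Spaces.linear (*s) (*s) U" "\<And>x. norm (U x) = norm x"
    "\<And>a. a \<in> A \<Longrightarrow> U a = \<phi> a"
  using gram
proof (induction "CARD('d) - vec.dim A" arbitrary: A \<phi> thesis rule: less_induct)
  case less
  obtain U where lin: "Vector_Spaces.linear (*s) (*s) U" and UA: "\<And>a. a \<in> A \<Longrightarrow> U a = \<phi> a"
    and nrm: "\<And>x. x \<in> vec.span A \<Longrightarrow> norm (U x) = norm x"
    using gram_linear_extension[of A \<phi>] less.prems(2) by blast
  show ?case
  proof (cases "vec.dim A < CARD('d)")
    case False
    have "vec.dim (UNIV :: (complex ^ 'd) set) \<le> vec.dim A"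
      using False by (simp only: vec_dim_card not_less)
    then have "vec.span A = vec.span UNIV"
      using vec.dim_eq_span[of A UNIV] by simp
    then have "vec.span A = UNIV" by simp
    then show ?thesis using less.prems(1)[OF lin _ UA] nrm by simp
  next
    case True
    obtain u where u: "norm u = 1" "\<And>a. a \<in> A \<Longrightarrow> cinner_vec u a = 0"
      using unit_vector_orthogonal_to_proper_subspace[OF True] by blast
    have "vec.dim (\<phi> ` A) \<le> vec.dim A"
    proof -
      have "\<phi> ` A = U ` A" using UA by auto
      then show ?thesis using vec.dim_image_le[OF lin, of A] by simp
    qed
    with True have "vec.dim (\<phi> ` A) < CARD('d)" by simp
    then obtain v where v: "norm v = 1" "\<And>b. b \<in> \<phi> ` A \<Longrightarrow> cinner_vec v b = 0"
      using unit_vector_orthogonal_to_proper_subspace by blast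
    have uA: "u \<notin> A" using u(2)[of u] u(1) by (auto simp: cinner_vec_self)
    have "u \<notin> vec.span A"
    proof
      assume us: "u \<in> vec.span A"
      have "cinner_vec u x = 0" if "x \<in> vec.span A" for x
        using that by (induction rule: vec.span_induct_alt) (simp_all add: cinner_vec_simps u)
      from this[OF us] show False using u(1) by (simp add: cinner_vec_self)
    qed
    then have dim: "vec.dim (insert u A) = vec.dim A + 1" by (simp add: vec.dim_insert)
    define \<psi> where "\<psi> = \<phi>(u := v)"
    have \<psi>A: "\<psi> a = \<phi> a" if "a \<in> A" for a using that uA by (auto simp: \<psi>_def)
    have \<psi>u: "\<psi> u = v" by (simp add: \<psi>_def)
    have flip: "cinner_vec x y = 0" if "cinner_vec y x = 0" for x y :: "complex ^ 'd"
      using that by (metis cnj_cinner_vec complex_cnj_zero)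
    have g: "cinner_vec (\<psi> a) (\<psi> b) = cinner_vec a b" if "a \<in> insert u A" "b \<in> insert u A" for a b
      using that less.prems(2) u v flip[OF u(2)] flip[OF v(2)]
      by (auto simp: \<psi>A \<psi>u cinner_vec_self)
    show ?thesis
    proof (rule less.hyps[of "insert u A" \<psi>])
      show "CARD('d) - vec.dim (insert u A) < CARD('d) - vec.dim A"
        using True dim by simp
      show thesis if "Vector_Spaces.linear (*s) (*s) W" "\<And>x. norm (W x) = norm x"
        "\<And>a. a \<in> insert u A \<Longrightarrow> W a = \<psi> a" for W
        using less.prems(1)[OF that(1,2)] that(3) \<psi>A by simp
    qed (rule g)
  qed
qed

section \<open>Congruence and isometry\<close>

lemma congruent_if_gram_equivalent:
  fixes A B :: "(complex ^ 'd) set"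
  assumes t: "0 < t" "t \<le> 2" and A: "A \<subseteq> ball 0 1" and B: "B \<subseteq> ball 0 1"
    and \<phi>: "bij_betw \<phi> A B"
    and gram: "\<And>a b. \<lbrakk>a \<in> A; b \<in> A\<rbrakk> \<Longrightarrow>
      ball_kernel t (\<phi> a) (\<phi> b) = f a * cnj (f b) * ball_kernel t a b"
  shows "congruent_in_ball A B"
proof (cases "A = {}")
  case True
  then have "B = {}" using \<phi> by (simp add: bij_betw_def)
  moreover have "biholomorphic_automorphism (ball 0 1) (ball_moebius (0 :: complex ^ 'd))"
    by (rule ball_moebius_automorphism) simp
  ultimately show ?thesis using True by (auto simp: congruent_in_ball_def)
next
  case False
  then obtain p where p: "p \<in> A" by blast
  define q where "q = \<phi> p"
  have q: "q \<in> B" using p \<phi> by (auto simp: q_def bij_betw_def)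
  have pb: "p \<in> ball 0 1" and qb: "q \<in> ball 0 1" using p q A B by auto
  define M where "M = ball_moebius p"
  define N where "N = ball_moebius q"
  have M: "biholomorphic_automorphism (ball 0 1) M" and N: "biholomorphic_automorphism (ball 0 1) N"
    using ball_moebius_automorphism pb qb by (auto simp: M_def N_def)
  have MM: "M (M x) = x" "M x \<in> ball 0 1" and NN: "N (N x) = x" "N x \<in> ball 0 1"
    if "x \<in> ball 0 1" for x
    using that ball_moebius_involution ball_moebius_in_ball pb qb unfolding M_def N_def by blast+
  have M0: "M 0 = p" "M p = 0" and N0: "N 0 = q" "N q = 0"
    using MM(1)[of 0] NN(1)[of 0] by (simp_all add: M_def N_def ball_moebius_0)
  obtain m where m: "\<And>x y. \<lbrakk>x \<in> ball 0 1; y \<in> ball 0 1\<rbrakk> \<Longrightarrow>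
       ball_kernel t (M x) (M y) = m x * cnj (m y) * ball_kernel t x y"
    by (rule automorphism_ball_kernel[OF M, of t]) (rule that; assumption)
  obtain n where n: "\<And>x y. \<lbrakk>x \<in> ball 0 1; y \<in> ball 0 1\<rbrakk> \<Longrightarrow>
       ball_kernel t (N x) (N y) = n x * cnj (n y) * ball_kernel t x y"
    by (rule automorphism_ball_kernel[OF N, of t]) (rule that; assumption)
  \<comment> \<open>\<open>\<phi>\<close> in coordinates centred at \<open>p\<close> and
    \<open>q\<close>; \<open>M\<close> serves as its own inverse.\<close>
  define \<rho> where "\<rho> x = N (\<phi> (M x))" for x
  define g where "g x = n (\<phi> (M x)) * f (M x) * m x" for x
  have A': "x \<in> ball 0 1" "M x \<in> A" "\<phi> (M x) \<in> ball 0 1" if "x \<in> M ` A" for x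
  proof -
    obtain a where a: "a \<in> A" "x = M a" using \<open>x \<in> M ` A\<close> by blast
    have ab: "a \<in> ball 0 1" using a A by blast
    then show "x \<in> ball 0 1" using MM(2) a by blast
    have "M x = a" using MM(1)[OF ab] a by simp
    then show "M x \<in> A" "\<phi> (M x) \<in> ball 0 1"
      using a B bij_betw_apply[OF \<phi> a(1)] by auto
  qed
  have g: "ball_kernel t (\<rho> x) (\<rho> y) = g x * cnj (g y) * ball_kernel t x y"
    if "x \<in> M ` A" "y \<in> M ` A" for x y
    using n[OF A'(3)[OF that(1)] A'(3)[OF that(2)]] gram[OF A'(2)[OF that(1)] A'(2)[OF that(2)]]
      m[OF A'(1)[OF that(1)] A'(1)[OF that(2)]] by (simp add: \<rho>_def g_def)
  have \<rho>b: "\<rho> x \<in> ball 0 1" if "x \<in> M ` A" for x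
    unfolding \<rho>_def using NN(2) A'(3)[OF that] by blast
  have 0: "0 \<in> M ` A" using p M0 by force
  have \<rho>0: "\<rho> 0 = 0" using M0 N0 by (simp add: \<rho>_def q_def)
  \<comment> \<open>\<open>\<rho>\<close> fixes 0, and the kernel is 1 whenever one argument is
    0.\<close>
  have one: "g x * cnj (g 0) = 1" "g 0 * cnj (g x) = 1" if "x \<in> M ` A" for x
    using g[OF that 0] g[OF 0 that] by (simp_all add: \<rho>0 ball_kernel_def)
  have "g x * cnj (g y) = 1" if "x \<in> M ` A" "y \<in> M ` A" for x y
  proof -
    \<comment> \<open>Two products through the base point 0 give the general one, as
      \<open>g 0\<close> is unimodular.\<close>
    have "(g x * cnj (g 0)) * (g 0 * cnj (g y)) = (g x * cnj (g y)) * (g 0 * cnj (g 0))" by simp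
    then show ?thesis using one that 0 by simp
  qed
  then have keq: "ball_kernel t (\<rho> x) (\<rho> y) = ball_kernel t x y" if "x \<in> M ` A" "y \<in> M ` A" for x y
    using g[OF that] that by simp
  have "cinner_vec (\<rho> x) (\<rho> y) = cinner_vec x y" if "x \<in> M ` A" "y \<in> M ` A" for x y
  proof -
    have "(1 - cinner_vec (\<rho> x) (\<rho> y)) powr t = (1 - cinner_vec x y) powr t"
      using keq[OF that] by (simp add: ball_kernel_def)
    from powr_inj_right_half_plane[OF t Re_one_minus_cinner_vec_pos[OF \<rho>b[OF that(1)] \<rho>b[OF that(2)]]
        Re_one_minus_cinner_vec_pos[OF A'(1)[OF that(1)] A'(1)[OF that(2)]] this]
    show ?thesis by simp
  qed
  then obtain U where U: "Vector_Spaces.linear (*s) (*s) U" "\<And>x. norm (U x) = norm x"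
    and U\<rho>: "\<And>x. x \<in> M ` A \<Longrightarrow> U x = \<rho> x"
    using gram_unitary_extension[of "M ` A" \<rho>] by blast
  define F where "F = N \<circ> (U \<circ> M)"
  have "biholomorphic_automorphism (ball 0 1) F"
    unfolding F_def
    by (intro biholomorphic_automorphism_compose M N linear_isometry_biholomorphic U open_ball)
  moreover have "F a = \<phi> a" if a: "a \<in> A" for a
  proof -
    have ab: "a \<in> ball 0 1" "\<phi> a \<in> ball 0 1" using a A B bij_betw_apply[OF \<phi> a] by blast+
    show ?thesis
      using U\<rho>[OF imageI[OF a]] MM(1)[OF ab(1)] NN(1)[OF ab(2)] by (simp add: F_def \<rho>_def)
  qed
  then have "F ` A = B" using \<phi> by (auto simp: bij_betw_def)
  ultimately show ?thesis by (auto simp: congruent_in_ball_def)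
qed

section \<open>A rigid triangle and its mirror image\<close>

text \<open>The squared cosine of the angle between the kernel functions at \<open>x\<close> and \<open>y\<close> for \<open>t = 1\<close>.\<close>

definition ball_angle :: "complex ^ 'd \<Rightarrow> complex ^ 'd \<Rightarrow> real" where
  "ball_angle x y = (1 - (norm x)\<^sup>2) * (1 - (norm y)\<^sup>2) / (cmod (1 - cinner_vec x y))\<^sup>2"

lemma ball_angle_commute: "ball_angle x y = ball_angle y x"
proof -
  have "cmod (1 - cinner_vec x y) = cmod (cnj (1 - cinner_vec x y))"
    by (rule complex_mod_cnj[symmetric])
  then have "cmod (1 - cinner_vec x y) = cmod (1 - cinner_vec y x)"
    by (simp only: complex_cnj_diff complex_cnj_one cnj_cinner_vec)
  then show ?thesis by (simp add: ball_angle_def mult.commute)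
qed

lemma ball_angle_0: "ball_angle 0 y = 1 - (norm y)\<^sup>2"
  by (simp add: ball_angle_def)

lemma cmod_one_minus_cinner_vec_self:
  assumes "x \<in> ball 0 1"
  shows "cmod (1 - cinner_vec x x) = 1 - (norm x)\<^sup>2" "0 < 1 - (norm x)\<^sup>2"
proof -
  show pos: "0 < 1 - (norm x)\<^sup>2" using assms by (simp add: power_less_one_iff)
  have "1 - cinner_vec x x = of_real (1 - (norm x)\<^sup>2)" by (simp add: cinner_vec_self)
  then show "cmod (1 - cinner_vec x x) = 1 - (norm x)\<^sup>2"
    using pos by (simp only: norm_of_real abs_of_pos)
qed

lemma ball_angle_self: "x \<in> ball 0 1 \<Longrightarrow> ball_angle x x = 1"
  using cmod_one_minus_cinner_vec_self[of x] by (simp add: ball_angle_def power2_eq_square)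

lemma ball_angle_kernel:
  assumes "x \<in> ball 0 1" "y \<in> ball 0 1"
  shows "ball_angle x y = (cmod (ball_kernel 1 x y))\<^sup>2 / (cmod (ball_kernel 1 x x) * cmod (ball_kernel 1 y y))"
  using cmod_one_minus_cinner_vec_self[OF assms(1)] cmod_one_minus_cinner_vec_self[OF assms(2)]
    one_minus_cinner_vec_nonzero[OF assms] one_minus_cinner_vec_nonzero[OF assms(1) assms(1)]
    one_minus_cinner_vec_nonzero[OF assms(2) assms(2)]
  by (simp add: ball_angle_def ball_kernel_def norm_divide power_divide)

text \<open>The weights contribute the same absolute values to numerator and denominator. The
  invariant tells which vertices of a triangle an automorphism can exchange.\<close>

lemma automorphism_ball_angle:
  assumes F: "biholomorphic_automorphism (ball 0 1) F" and x: "x \<in> ball 0 1" and y: "y \<in> ball 0 1"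
  shows "ball_angle (F x) (F y) = ball_angle x y"
proof -
  obtain f where f: "\<And>x. x \<in> ball 0 1 \<Longrightarrow> f x \<noteq> 0"
    and k: "\<And>x y. \<lbrakk>x \<in> ball 0 1; y \<in> ball 0 1\<rbrakk> \<Longrightarrow>
       ball_kernel 1 (F x) (F y) = f x * cnj (f y) * ball_kernel 1 x y"
    by (rule automorphism_ball_kernel[OF F, of 1]) (rule that; assumption)
  have FB: "F x \<in> ball 0 1" "F y \<in> ball 0 1"
    using F x y by (metis biholomorphic_automorphism_def bij_betw_apply)+
  show ?thesis
    using f[OF x] f[OF y] ball_kernel_nonzero[OF x x, of 1] ball_kernel_nonzero[OF y y, of 1]
    unfolding ball_angle_kernel[OF FB] ball_angle_kernel[OF x y]
    by (simp add: k x y norm_mult power_mult_distrib power2_eq_square field_simps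
        del: mem_ball mem_ball_0)
qed

section \<open>Construction of the triangle\<close>

lemma cinner_vec_axis: "cinner_vec (axis j b) (axis j c) = b * cnj c"
  by (simp add: cinner_vec_def axis_def if_distrib if_distribR cong: if_cong)

lemma norm_axis_complex: "norm (axis j c :: complex ^ 'd) = cmod c"
proof -
  have "cinner_vec (axis j c :: complex ^ 'd) (axis j c) = c * cnj c"
    by (rule cinner_vec_axis)
  then have "complex_of_real ((norm (axis j c :: complex ^ 'd))\<^sup>2) = of_real ((cmod c)\<^sup>2)"
    by (simp add: cinner_vec_self complex_norm_square del: of_real_power)
  then have "(norm (axis j c :: complex ^ 'd))\<^sup>2 = (cmod c)\<^sup>2"
    using of_real_eq_iff by blast
  then show ?thesis by simp
qed

text \<open>The three angles are pairwise distinct, so a congruence must fix 0 and \<open>x\<close>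
  and send \<open>y\<close> to \<open>z\<close>. It then preserves inner products, which would make
  \<open>w\<close> real.\<close>

lemma not_congruent_gram_equal:
  fixes t :: real
  assumes t: "t > 2"
  obtains A B :: "(complex ^ 'd) set" and \<phi> where
    "A \<subseteq> ball 0 1" "B \<subseteq> ball 0 1" "\<not> congruent_in_ball A B" "bij_betw \<phi> A B"
    "\<And>a b. \<lbrakk>a \<in> A; b \<in> A\<rbrakk> \<Longrightarrow> ball_kernel t (\<phi> a) (\<phi> b) = ball_kernel t a b"
proof -
  define \<theta> where "\<theta> = pi / t"
  have \<theta>: "0 < \<theta>" "\<theta> < pi / 2" "t * \<theta> = pi"
    using t by (auto simp: \<theta>_def field_simps)
  define S where "S = sin \<theta>"
  define C where "C = cos \<theta>"
  have C: "C > 0" using \<theta> by (auto simp: C_def intro: cos_gt_zero_pi)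
  have S: "S > 0" using \<theta> by (auto simp: S_def intro: sin_gt_zero)
  have SC: "S\<^sup>2 + C\<^sup>2 = 1" by (simp add: S_def C_def)
  have S1: "S < 1" using SC C S by (smt (verit) one_le_power zero_less_power)
  \<comment> \<open>\<open>1 - w\<close> is the point of the ray with argument
    \<open>\<theta>\<close> closest to 1, so \<open>|w| = sin \<theta> < 1\<close> and
    \<open>w\<close> can be an inner product of points of the ball.\<close>
  define w where "w = 1 - complex_of_real C * cis \<theta>"
  have w_re_im: "Re w = S\<^sup>2" "Im w = - (S * C)"
    using SC by (simp_all add: w_def C_def S_def power2_eq_square algebra_simps)
  have "(cmod w)\<^sup>2 = S\<^sup>2 * (S\<^sup>2 + C\<^sup>2)"
    unfolding cmod_power2 w_re_im by (simp add: power2_eq_square algebra_simps)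
  then have norm_w: "cmod w = S" using SC S by simp
  have Im_w: "Im w \<noteq> 0" using w_re_im S C by simp
  have w1: "1 - w = exp (of_real (ln C) + \<i> * of_real \<theta>)"
    "1 - cnj w = exp (of_real (ln C) - \<i> * of_real \<theta>)"
    using exp_of_real[of "ln C", where 'a = complex] C
    by (simp_all add: w_def exp_add exp_diff cis_conv_exp exp_cnj exp_minus divide_inverse)
  have Ln_w: "Ln (1 - w) = of_real (ln C) + \<i> * of_real \<theta>"
    "Ln (1 - cnj w) = of_real (ln C) - \<i> * of_real \<theta>"
    unfolding w1 using \<theta> pi_gt_zero by (auto intro!: Ln_exp)
  \<comment> \<open>The arguments become pi and -pi, so both powers are the same negative
    real.\<close>
  have tLn: "of_real t * Ln (1 - w) = of_real (t * ln C) + of_real pi * \<i>"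
    "of_real t * Ln (1 - cnj w) = of_real (t * ln C) - of_real pi * \<i>"
    unfolding Ln_w \<theta>(3)[symmetric] by (simp_all add: algebra_simps)
  have nz: "1 - w \<noteq> 0" "1 - cnj w \<noteq> 0" unfolding w1 by simp_all
  have powr_eq: "(1 - w) powr t = (1 - cnj w) powr t"
    using nz by (simp add: powr_def tLn exp_add exp_diff)

  \<comment> \<open>On one complex line the norms of \<open>x\<close> and \<open>y\<close> multiply
    to \<open>|w| = S\<close>. The lower bound on \<open>s\<close> gives \<open>r < s\<close>, hence
    \<open>\<alpha> < \<beta>\<close>; \<open>s < 1\<close> gives \<open>r > S\<close>, hence
    \<open>\<gamma> < \<alpha>\<close>.\<close>
  obtain s where s: "sqrt S < s" "s < 1" using S1 dense by (metis real_sqrt_lt_1_iff)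
  have s0: "s > 0" using s(1) S real_sqrt_gt_zero[of S] by linarith
  have "(sqrt S)\<^sup>2 < s\<^sup>2" using s S by (intro power_strict_mono) auto
  then have Ss: "S < s\<^sup>2" using S by simp
  define r where "r = S / s"
  have r: "0 < r" "r < s" "S < r"
    using S s0 s(2) Ss by (auto simp: r_def field_simps power2_eq_square)
  \<comment> \<open>Any coordinate line will do, which covers every dimension, including 1.\<close>
  define j :: 'd where "j = undefined"
  define x :: "complex ^ 'd" where "x = axis j (of_real s)"
  define y :: "complex ^ 'd" where "y = axis j (cnj w / of_real s)"
  define z :: "complex ^ 'd" where "z = axis j (w / of_real s)"
  have nx: "norm x = s" and ny: "norm y = r" and nz': "norm z = r"
    using s0 by (simp_all add: x_def y_def z_def norm_axis_complex norm_divide norm_w r_def)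
  have xy: "cinner_vec x y = w" and xz: "cinner_vec x z = cnj w"
    using s0 by (simp_all add: x_def y_def z_def cinner_vec_axis)
  have yx: "cinner_vec y x = cnj w" and zx: "cinner_vec z x = w"
    by (metis xy xz cnj_cinner_vec complex_cnj_cnj)+
  have ball: "0 \<in> ball 0 (1::real)" "x \<in> ball 0 1" "y \<in> ball 0 1" "z \<in> ball 0 1"
    using nx ny nz' r s by simp_all
  have distinct: "x \<noteq> 0" "y \<noteq> 0" "z \<noteq> 0" "x \<noteq> y" "x \<noteq> z"
    using nx ny nz' r s0 by auto
  define \<alpha> where "\<alpha> = 1 - s\<^sup>2"
  define \<beta> where "\<beta> = 1 - r\<^sup>2"
  define \<gamma> where "\<gamma> = \<alpha> * \<beta> / C\<^sup>2"
  have r2: "r\<^sup>2 < s\<^sup>2" "S\<^sup>2 < r\<^sup>2" using r S by (auto intro: power_strict_mono)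
  have \<alpha>: "0 < \<alpha>" using s s0 by (simp add: \<alpha>_def power_less_one_iff)
  have \<alpha>\<beta>: "\<alpha> < \<beta>" "\<beta> < 1" using r2 r by (simp_all add: \<alpha>_def \<beta>_def)
  have "\<beta> < C\<^sup>2" using r2 SC by (simp add: \<beta>_def)
  then have \<gamma>\<alpha>: "\<gamma> < \<alpha>" using \<alpha> C by (simp add: \<gamma>_def field_simps)
  have "cmod (1 - w) = C" "cmod (1 - cnj w) = C"
    using C by (simp_all add: w_def norm_mult)
  then have angle: "ball_angle 0 x = \<alpha>" "ball_angle 0 y = \<beta>" "ball_angle 0 z = \<beta>"
    "ball_angle x y = \<gamma>" "ball_angle x z = \<gamma>"
    by (simp_all add: ball_angle_0 nx ny nz' \<alpha>_def \<beta>_def \<gamma>_def ball_angle_def xy xz)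
  note angle' = angle angle[THEN trans[OF ball_angle_commute]]

  define A where "A = {0, x, y}"
  define B where "B = {0, x, z}"
  define \<phi> where "\<phi> a = (if a = y then z else a)" for a
  have "\<not> congruent_in_ball A B"
  proof
    assume "congruent_in_ball A B"
    then obtain F where F: "biholomorphic_automorphism (ball 0 1) F" and FA: "F ` A = B"
      by (auto simp: congruent_in_ball_def)
    have self: "ball_angle 0 0 = 1" "ball_angle x x = 1" "ball_angle z z = 1"
      using ball ball_angle_self by blast+
    have ne: "\<alpha> \<noteq> 1" "\<beta> \<noteq> 1" "\<alpha> \<noteq> \<beta>" "\<gamma> \<noteq> \<alpha>" "\<gamma> \<noteq> \<beta>"
      using \<alpha>\<beta> \<gamma>\<alpha> by auto
    have \<alpha>D: "p = 0 \<and> q = x \<or> p = x \<and> q = 0"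
      if "ball_angle p q = \<alpha>" "p \<in> {0, x, z}" "q \<in> {0, x, z}" for p q
      using that(2,3) by (elim insertE emptyE) (use that(1) in \<open>simp_all add: angle' self ne ne[symmetric]\<close>)
    have \<beta>D: "p = 0 \<and> q = z \<or> p = z \<and> q = 0"
      if "ball_angle p q = \<beta>" "p \<in> {0, x, z}" "q \<in> {0, x, z}" for p q
      using that(2,3) by (elim insertE emptyE) (use that(1) in \<open>simp_all add: angle' self ne ne[symmetric]\<close>)
    have "F 0 \<in> {0, x, z}" "F x \<in> {0, x, z}" "F y \<in> {0, x, z}"
      using FA unfolding A_def B_def by blast+
    moreover have "ball_angle (F 0) (F x) = \<alpha>" "ball_angle (F 0) (F y) = \<beta>"
      using automorphism_ball_angle[OF F ball(1,2)] automorphism_ball_angle[OF F ball(1,3)] angle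
      by simp_all
    \<comment> \<open>The edges with angles \<open>\<alpha>\<close> and \<open>\<beta>\<close> meet
      only in 0, which pins down \<open>F 0\<close> and then the other vertices.\<close>
    ultimately have "F 0 = 0" "F x = x" "F y = z"
      using \<alpha>D[of "F 0" "F x"] \<beta>D[of "F 0" "F y"] distinct by metis+
    then have "cnj w = w"
      using automorphism_fixing_0_cinner[OF F _ ball(2,3)] by (simp add: xy xz)
    then show False using Im_w by (simp add: complex_eq_iff)
  qed
  moreover have "bij_betw \<phi> A B"
    using distinct by (auto simp: bij_betw_def inj_on_def A_def B_def \<phi>_def)
  \<comment> \<open>Only the pairing of \<open>x\<close> with \<open>y\<close> changes, from
    \<open>w\<close> to its conjugate (or back), and \<open>powr_eq\<close> hides this.\<close>
  moreover have "ball_kernel t (\<phi> a) (\<phi> b) = ball_kernel t a b" if "a \<in> A" "b \<in> A" for a b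
    using that distinct powr_eq
    by (auto simp: A_def \<phi>_def ball_kernel_def xy xz yx zx cinner_vec_self ny nz')
  moreover have "A \<subseteq> ball 0 1" "B \<subseteq> ball 0 1" using ball by (auto simp: A_def B_def)
  ultimately show ?thesis using that by blast
qed

theorem theorem1p5:
  fixes t :: real
    and H :: "(complex ^ 'd \<Rightarrow> complex) set"
    and ip :: "(complex ^ 'd \<Rightarrow> complex) \<Rightarrow> (complex ^ 'd \<Rightarrow> complex) \<Rightarrow> complex"
  assumes "t > 0"
    and "hilbert_function_space_with_kernel (ball 0 1) H ip (ball_kernel t)"
  shows "(t \<le> 2 \<longrightarrow>
      (\<forall>A B. A \<subseteq> ball 0 1 \<longrightarrow> B \<subseteq> ball 0 1 \<longrightarrow>
        (isometric_kernel_subspaces H ip (kernel_fun (ball 0 1) (ball_kernel t)) A B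
          \<longleftrightarrow> congruent_in_ball A B)))
    \<and> (t > 2 \<longrightarrow>
      (\<exists>A B. A \<subseteq> ball 0 1 \<and> B \<subseteq> ball 0 1 \<and> \<not> congruent_in_ball A B \<and>
        isometric_kernel_subspaces H ip (kernel_fun (ball 0 1) (ball_kernel t)) A B))"
proof (intro conjI impI allI iffI)
  interpret hilbert_function_space_with_kernel "ball 0 1" H ip "ball_kernel t"
    by (rule assms(2))
  {
    fix A B :: "(complex ^ 'd) set"
    assume t: "t \<le> 2" and A: "A \<subseteq> ball 0 1" and B: "B \<subseteq> ball 0 1"
    assume iso: "isometric_kernel_subspaces H ip K A B"
    have nz: "ball_kernel t a a \<noteq> 0" if "a \<in> A" for a
      using ball_kernel_nonzero A that by blast
    obtain \<phi> f where "bij_betw \<phi> A B" "\<And>a b. \<lbrakk>a \<in> A; b \<in> A\<rbrakk> \<Longrightarrow>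
        ball_kernel t (\<phi> a) (\<phi> b) = f a * cnj (f b) * ball_kernel t a b"
      by (rule isometric_kernel_subspacesD[OF A B nz iso]) (assumption, (rule that; assumption))
    then show "congruent_in_ball A B"
      by (rule congruent_if_gram_equivalent[OF \<open>t > 0\<close> t A B])
  next
    fix A B :: "(complex ^ 'd) set"
    assume A: "A \<subseteq> ball 0 1" and B: "B \<subseteq> ball 0 1"
    assume "congruent_in_ball A B"
    then obtain F where F: "biholomorphic_automorphism (ball 0 1) F" and FA: "F ` A = B"
      by (auto simp: congruent_in_ball_def)
    obtain f where f: "\<And>x. x \<in> ball 0 1 \<Longrightarrow> f x \<noteq> 0"
      "\<And>x y. \<lbrakk>x \<in> ball 0 1; y \<in> ball 0 1\<rbrakk> \<Longrightarrow>
        ball_kernel t (F x) (F y) = f x * cnj (f y) * ball_kernel t x y"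
      by (rule automorphism_ball_kernel[OF F, of t]) (rule that; assumption)
    have "bij_betw F (ball 0 1) (ball 0 1)"
      using F by (simp add: biholomorphic_automorphism_def)
    then have bij: "bij_betw F A B"
      by (rule bij_betw_subset[OF _ A FA])
    show "isometric_kernel_subspaces H ip K A B"
      using f A by (intro isometric_kernel_subspacesI[OF A B bij, of f]) blast+
  next
    assume "t > 2"
    then obtain A B :: "(complex ^ 'd) set" and \<phi> where AB: "A \<subseteq> ball 0 1" "B \<subseteq> ball 0 1"
      "\<not> congruent_in_ball A B" "bij_betw \<phi> A B"
      "\<And>a b. \<lbrakk>a \<in> A; b \<in> A\<rbrakk> \<Longrightarrow> ball_kernel t (\<phi> a) (\<phi> b) = ball_kernel t a b"
      by (rule not_congruent_gram_equal) (rule that; assumption)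
    have "isometric_kernel_subspaces H ip K A B"
      by (rule isometric_kernel_subspacesI[OF AB(1,2,4), of "\<lambda>_. 1"]) (simp_all add: AB(5))
    with AB show "\<exists>A B. A \<subseteq> ball 0 1 \<and> B \<subseteq> ball 0 1 \<and> \<not> congruent_in_ball A B \<and>
        isometric_kernel_subspaces H ip K A B"
      by blast
  }
qed

end
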